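(* Let $\mathcal F$ be a class of finitely generated structures with the joint embedding property and with countably many isomorphism types. (1) If there is a family $\mathcal U \subseteq \sigma\mathcal F$ of cardinality strictly less than the continuum such that Odd has a winning strategy in $\mathrm{BM}(\mathcal F, \mathcal U^{\hookleftarrow})$, then $\mathcal F$ has the weak amalgamation property, and consequently there exists a unique (up to isomorphism) $U \in \sigma\mathcal F$ such that Odd has a winning strategy in the game $\mathrm{BM}(\mathcal F, U)$. The structure $U$ is characterized by weak $\mathcal F$-injectivity or, equivalently, by $\mathcal F$-universality and prehomogeneity; that is, for $M \in \sigma\mathcal F$ the following are equivalent: $M$ is isomorphic to $U$; $M$ is weakly $\mathcal F$-injective; $M$ is $\mathcal F$-universal and prehomogeneous. (2) If $\mathcal F$ fails the weak amalgamation property, then for every $W \in \sigma\mathcal F$ Eve has a winning strategy in $\mathrm{BM}(\mathcal F, W^{\hookleftarrow})$; her strategy is also winning in the game $\mathrm{BM}(\mathcal F, W)$.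
   Context: Fix a countable first-order signature. $\mathcal F$ is a class, closed under isomorphisms, of countable finitely generated structures in this signature. $X \leq Y$ means that $X$ is a substructure of $Y$. $\sigma\mathcal F$ is the class of all structures of the form $\bigcup_{n\in\omega} X_n$, where $X_0 \leq X_1 \leq X_2 \leq \cdots$ is a chain of structures from $\mathcal F$. Games: two players, Eve and Odd, alternately build a chain $A_0 \leq A_1 \leq A_2 \leq \cdots$ of structures from the (nonempty) class $\mathcal F$. Eve starts by choosing $A_0 \in \mathcal F$; Odd responds with $A_1 \in \mathcal F$, $A_1 \geq A_0$; Eve responds with $A_2 \in \mathcal F$, $A_2 \geq A_1$; and so on (Eve chooses $A_n$ for even $n$, Odd for odd $n$). Let $A_\infty = \bigcup_{n\in\omega} A_n$. In $\mathrm{BM}(\mathcal F, G)$ Odd wins if $A_\infty$ is isomorphic to $G$. In $\mathrm{BM}(\mathcal F, \mathcal U^{\hookleftarrow})$ Odd wins if $A_\infty$ embeds into some $U \in \mathcal U$; $\mathrm{BM}(\mathcal F, W^{\hookleftarrow})$ is the case $\mathcal U = \{W\}$. Otherwise Eve wins. A strategy prescribes a player's move as a function of the finite sequence of previous moves; it is winning if the player wins every play in which it is followed. $\mathcal F$ has the joint embedding property (JEP) if for all $X, Y \in \mathcal F$ there is $Z \in \mathcal F$ such that both $X$ and $Y$ embed into $Z$. $\mathcal F$ has the weak amalgamation property (WAP) if for every $Z \in \mathcal F$ there is $Z' \in \mathcal F$ with $Z \leq Z'$ such that for all embeddings $f\colon Z' \to X$, $g\colon Z' \to Y$ with $X, Y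 \in \mathcal F$ there exist $V \in \mathcal F$ and embeddings $f'\colon X \to V$, $g'\colon Y \to V$ satisfying $f'\circ f \restriction Z = g' \circ g\restriction Z$. A structure $G \in \sigma\mathcal F$ is $\mathcal F$-universal if every structure from $\mathcal F$ embeds into $G$. It is weakly $\mathcal F$-injective if it is $\mathcal F$-universal and, for every $A \leq G$ with $A \in \mathcal F$, there is $B \in \mathcal F$ such that $A \leq B \leq G$ and for every $X \in \mathcal F$ with $B \leq X$ there exists an embedding $f\colon X \to G$ with $f\restriction A = \mathrm{id}_A$. A structure $M$ is prehomogeneous if for every finitely generated substructure $A$ of $M$ there is a finitely generated substructure $B$ of $M$ containing $A$ such that every embedding of $A$ into $M$ that extends to an embedding of $B$ into $M$ extends to an automorphism of $M$. *)

theory Defs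
  imports Complex_Main "HOL-Library.Countable_Set" "HOL-Library.Equipollence"
begin

section \<open>First-order structures\<close>

text \<open>
  The symbols of a signature form sets rather than whole types, so that a signature may have no
  function symbols or no relation symbols. Constants are function symbols of arity 0.
\<close>

record ('f, 'r) signature =
  funs :: "'f set"
  rels :: "'r set"
  fun_ar :: "'f \<Rightarrow> nat"
  rel_ar :: "'r \<Rightarrow> nat"

definition countable_signature :: "('f, 'r) signature \<Rightarrow> bool" where
  "countable_signature S \<longleftrightarrow> countable (funs S) \<and> countable (rels S)"

record ('f, 'r, 'a) fo_structure =
  carrier :: "'a set"
  fn :: "'f \<Rightarrow> 'a list \<Rightarrow> 'a"
  rl :: "'r \<Rightarrow> 'a list \<Rightarrow> bool"

definition fun_args :: "('f, 'r) signature \<Rightarrow> 'a set \<Rightarrow> 'f \<Rightarrow> 'a list \<Rightarrow> bool" where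
  "fun_args S C f xs \<longleftrightarrow> f \<in> funs S \<and> length xs = fun_ar S f \<and> set xs \<subseteq> C"

definition rel_args :: "('f, 'r) signature \<Rightarrow> 'a set \<Rightarrow> 'r \<Rightarrow> 'a list \<Rightarrow> bool" where
  "rel_args S C r xs \<longleftrightarrow> r \<in> rels S \<and> length xs = rel_ar S r \<and> set xs \<subseteq> C"

text \<open>
  Outside their proper arguments, operations and relations take a fixed junk value; hence equality
  of structures in the logic is equality of structures in the usual sense. Empty carriers are
  admitted (when the signature has no constants).
\<close>

definition is_structure :: "('f, 'r) signature \<Rightarrow> ('f, 'r, 'a) fo_structure \<Rightarrow> bool" where
  "is_structure S A \<longleftrightarrow>
     (\<forall>f xs. fun_args S (carrier A) f xs \<longrightarrow> fn A f xs \<in> carrier A) \<and>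
     (\<forall>f xs. \<not> fun_args S (carrier A) f xs \<longrightarrow> fn A f xs = undefined) \<and>
     (\<forall>r xs. rl A r xs \<longrightarrow> rel_args S (carrier A) r xs)"

definition substructure ::
  "('f, 'r) signature \<Rightarrow> ('f, 'r, 'a) fo_structure \<Rightarrow> ('f, 'r, 'a) fo_structure \<Rightarrow> bool" where
  "substructure S A B \<longleftrightarrow>
     is_structure S A \<and> is_structure S B \<and> carrier A \<subseteq> carrier B \<and>
     (\<forall>f xs. fun_args S (carrier A) f xs \<longrightarrow> fn A f xs = fn B f xs) \<and>
     (\<forall>r xs. rel_args S (carrier A) r xs \<longrightarrow> rl A r xs = rl B r xs)"

text \<open>The values of an embedding outside the carrier of its domain are irrelevant.\<close>

definition embedding ::
  "('f, 'r) signature \<Rightarrow> ('a \<Rightarrow> 'a) \<Rightarrow> ('f, 'r, 'a) fo_structure \<Rightarrow> ('f, 'r, 'a) fo_structure \<Rightarrow> bool" where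
  "embedding S h A B \<longleftrightarrow>
     is_structure S A \<and> is_structure S B \<and>
     h ` carrier A \<subseteq> carrier B \<and> inj_on h (carrier A) \<and>
     (\<forall>f xs. fun_args S (carrier A) f xs \<longrightarrow> h (fn A f xs) = fn B f (map h xs)) \<and>
     (\<forall>r xs. rel_args S (carrier A) r xs \<longrightarrow> rl A r xs = rl B r (map h xs))"

definition isomorphism ::
  "('f, 'r) signature \<Rightarrow> ('a \<Rightarrow> 'a) \<Rightarrow> ('f, 'r, 'a) fo_structure \<Rightarrow> ('f, 'r, 'a) fo_structure \<Rightarrow> bool" where
  "isomorphism S h A B \<longleftrightarrow> embedding S h A B \<and> h ` carrier A = carrier B"

definition embeds ::
  "('f, 'r) signature \<Rightarrow> ('f, 'r, 'a) fo_structure \<Rightarrow> ('f, 'r, 'a) fo_structure \<Rightarrow> bool" where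
  "embeds S A B \<longleftrightarrow> (\<exists>h. embedding S h A B)"

definition isomorphic ::
  "('f, 'r) signature \<Rightarrow> ('f, 'r, 'a) fo_structure \<Rightarrow> ('f, 'r, 'a) fo_structure \<Rightarrow> bool" where
  "isomorphic S A B \<longleftrightarrow> (\<exists>h. isomorphism S h A B)"

definition finitely_generated :: "('f, 'r) signature \<Rightarrow> ('f, 'r, 'a) fo_structure \<Rightarrow> bool" where
  "finitely_generated S A \<longleftrightarrow>
     is_structure S A \<and>
     (\<exists>G. finite G \<and> G \<subseteq> carrier A \<and> (\<forall>B. substructure S B A \<and> G \<subseteq> carrier B \<longrightarrow> B = A))"

section \<open>Classes of finitely generated structures\<close>

text \<open>
  A class of countable structures closed under isomorphisms is represented by the set of its members
  whose carriers are subsets of the type \<open>'a\<close>. When \<open>'a\<close> is uncountable, nothing is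
  lost: every countable structure has an isomorphic copy on a subset of \<open>'a\<close>, and whenever a
  countable structure \<open>X\<close> over \<open>'a\<close> embeds into a countable structure \<open>Y\<close>, there is a
  copy of \<open>Y\<close> over \<open>'a\<close> that contains \<open>X\<close> as a substructure. (Over a countable type
  this fails: a structure whose carrier is the whole type has no proper extension.)
\<close>

definition fg_class :: "('f, 'r) signature \<Rightarrow> ('f, 'r, 'a) fo_structure set \<Rightarrow> bool" where
  "fg_class S F \<longleftrightarrow>
     (\<forall>A\<in>F. countable (carrier A) \<and> finitely_generated S A) \<and>
     (\<forall>A\<in>F. \<forall>B. isomorphic S A B \<longrightarrow> B \<in> F)"

definition countably_many_iso_types ::
  "('f, 'r) signature \<Rightarrow> ('f, 'r, 'a) fo_structure set \<Rightarrow> bool" where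
  "countably_many_iso_types S F \<longleftrightarrow>
     countable (F // {(A, B). A \<in> F \<and> B \<in> F \<and> isomorphic S A B})"

definition chain_union ::
  "('f, 'r) signature \<Rightarrow> (nat \<Rightarrow> ('f, 'r, 'a) fo_structure) \<Rightarrow> ('f, 'r, 'a) fo_structure" where
  "chain_union S X =
     \<lparr> carrier = (\<Union>n. carrier (X n)),
       fn = (\<lambda>f xs. if fun_args S (\<Union>n. carrier (X n)) f xs
                    then fn (X (LEAST n. set xs \<subseteq> carrier (X n))) f xs
                    else undefined),
       rl = (\<lambda>r xs. \<exists>n. rl (X n) r xs) \<rparr>"

definition chain_in ::
  "('f, 'r) signature \<Rightarrow> ('f, 'r, 'a) fo_structure set \<Rightarrow> (nat \<Rightarrow> ('f, 'r, 'a) fo_structure) \<Rightarrow> bool" where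
  "chain_in S F X \<longleftrightarrow> (\<forall>n. X n \<in> F \<and> substructure S (X n) (X (Suc n)))"

definition sigma_class ::
  "('f, 'r) signature \<Rightarrow> ('f, 'r, 'a) fo_structure set \<Rightarrow> ('f, 'r, 'a) fo_structure set" where
  "sigma_class S F = {chain_union S X | X. chain_in S F X}"

definition JEP :: "('f, 'r) signature \<Rightarrow> ('f, 'r, 'a) fo_structure set \<Rightarrow> bool" where
  "JEP S F \<longleftrightarrow> (\<forall>X\<in>F. \<forall>Y\<in>F. \<exists>Z\<in>F. embeds S X Z \<and> embeds S Y Z)"

definition WAP :: "('f, 'r) signature \<Rightarrow> ('f, 'r, 'a) fo_structure set \<Rightarrow> bool" where
  "WAP S F \<longleftrightarrow>
     (\<forall>Z\<in>F. \<exists>Z'\<in>F. substructure S Z Z' \<and>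
        (\<forall>X\<in>F. \<forall>Y\<in>F. \<forall>f g. embedding S f Z' X \<and> embedding S g Z' Y \<longrightarrow>
           (\<exists>V\<in>F. \<exists>f' g'. embedding S f' X V \<and> embedding S g' Y V \<and>
              (\<forall>z\<in>carrier Z. f' (f z) = g' (g z)))))"

definition universal ::
  "('f, 'r) signature \<Rightarrow> ('f, 'r, 'a) fo_structure set \<Rightarrow> ('f, 'r, 'a) fo_structure \<Rightarrow> bool" where
  "universal S F G \<longleftrightarrow> G \<in> sigma_class S F \<and> (\<forall>X\<in>F. embeds S X G)"

definition weakly_injective ::
  "('f, 'r) signature \<Rightarrow> ('f, 'r, 'a) fo_structure set \<Rightarrow> ('f, 'r, 'a) fo_structure \<Rightarrow> bool" where
  "weakly_injective S F G \<longleftrightarrow>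
     universal S F G \<and>
     (\<forall>A\<in>F. substructure S A G \<longrightarrow>
        (\<exists>B\<in>F. substructure S A B \<and> substructure S B G \<and>
           (\<forall>X\<in>F. substructure S B X \<longrightarrow>
              (\<exists>f. embedding S f X G \<and> (\<forall>a\<in>carrier A. f a = a)))))"

definition prehomogeneous :: "('f, 'r) signature \<Rightarrow> ('f, 'r, 'a) fo_structure \<Rightarrow> bool" where
  "prehomogeneous S M \<longleftrightarrow>
     (\<forall>A. substructure S A M \<and> finitely_generated S A \<longrightarrow>
        (\<exists>B. substructure S B M \<and> finitely_generated S B \<and> substructure S A B \<and>
           (\<forall>e. embedding S e A M \<and>
                (\<exists>e'. embedding S e' B M \<and> (\<forall>a\<in>carrier A. e' a = e a)) \<longrightarrow>
                (\<exists>h. isomorphism S h M M \<and> (\<forall>a\<in>carrier A. h a = e a)))))"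

section \<open>Banach--Mazur games\<close>

datatype player = Eve | Odd

text \<open>A position is the list of the moves made so far; the move \<open>A\<^sub>n\<close> is made at a position of
  length \<open>n\<close>.\<close>

fun to_move :: "player \<Rightarrow> nat \<Rightarrow> bool" where
  "to_move Eve n \<longleftrightarrow> even n"
| "to_move Odd n \<longleftrightarrow> odd n"

definition position ::
  "('f, 'r) signature \<Rightarrow> ('f, 'r, 'a) fo_structure set \<Rightarrow> ('f, 'r, 'a) fo_structure list \<Rightarrow> bool" where
  "position S F p \<longleftrightarrow>
     set p \<subseteq> F \<and> (\<forall>i. Suc i < length p \<longrightarrow> substructure S (p ! i) (p ! Suc i))"

text \<open>A strategy has to prescribe a legal move at every position where the player is to move.\<close>

definition strategy ::
  "('f, 'r) signature \<Rightarrow> ('f, 'r, 'a) fo_structure set \<Rightarrow> player \<Rightarrow>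
   (('f, 'r, 'a) fo_structure list \<Rightarrow> ('f, 'r, 'a) fo_structure) \<Rightarrow> bool" where
  "strategy S F P s \<longleftrightarrow>
     (\<forall>p. position S F p \<and> to_move P (length p) \<longrightarrow> position S F (p @ [s p]))"

definition follows ::
  "player \<Rightarrow> (('f, 'r, 'a) fo_structure list \<Rightarrow> ('f, 'r, 'a) fo_structure) \<Rightarrow>
   (nat \<Rightarrow> ('f, 'r, 'a) fo_structure) \<Rightarrow> bool" where
  "follows P s A \<longleftrightarrow> (\<forall>n. to_move P n \<longrightarrow> A n = s (map A [0..<n]))"

text \<open>The argument \<open>T\<close> is the set of those results \<open>A\<^sub>\<infinity>\<close> with which Odd wins.\<close>

definition winning_strategy ::
  "('f, 'r) signature \<Rightarrow> ('f, 'r, 'a) fo_structure set \<Rightarrow> ('f, 'r, 'a) fo_structure set \<Rightarrow> player \<Rightarrow>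
   (('f, 'r, 'a) fo_structure list \<Rightarrow> ('f, 'r, 'a) fo_structure) \<Rightarrow> bool" where
  "winning_strategy S F T P s \<longleftrightarrow>
     strategy S F P s \<and>
     (\<forall>A. chain_in S F A \<and> follows P s A \<longrightarrow> (chain_union S A \<in> T \<longleftrightarrow> P = Odd))"

definition BM_iso_winning ::
  "('f, 'r) signature \<Rightarrow> ('f, 'r, 'a) fo_structure set \<Rightarrow> ('f, 'r, 'a) fo_structure \<Rightarrow> player \<Rightarrow>
   (('f, 'r, 'a) fo_structure list \<Rightarrow> ('f, 'r, 'a) fo_structure) \<Rightarrow> bool" where
  "BM_iso_winning S F G = winning_strategy S F {A. isomorphic S A G}"

definition BM_emb_winning ::
  "('f, 'r) signature \<Rightarrow> ('f, 'r, 'a) fo_structure set \<Rightarrow> ('f, 'r, 'a) fo_structure set \<Rightarrow> player \<Rightarrow>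
   (('f, 'r, 'a) fo_structure list \<Rightarrow> ('f, 'r, 'a) fo_structure) \<Rightarrow> bool" where
  "BM_emb_winning S F \<U> = winning_strategy S F {A. \<exists>U\<in>\<U>. embeds S A U}"

end

theory Submission
  imports Defs
begin

text \<open>
  If weak amalgamation fails at \<open>Z\<close>, then after any move \<open>A \<ge> Z\<close> Eve can choose between two
  extensions of \<open>A\<close> that do not embed into the same structure of \<open>\<sigma>F\<close> by maps agreeing
  on \<open>Z\<close>. Against one \<open>W\<close>, which has only countably many embeddings of the finitely generated
  \<open>Z\<close>, she excludes these embeddings one by one. Against a strategy of Odd, her choices form a
  binary tree of plays: the embeddings of the continuum many results restrict to distinct pairs of a
  structure in \<open>\<U>\<close> and one of countably many embeddings of \<open>Z\<close>, so \<open>\<U>\<close> has the size of the continuum.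

  With weak amalgamation, a chain that solves all extension problems (countably many up to
  isomorphism) has a weakly injective union \<open>U\<close>. In the game for a weakly injective structure Odd
  can follow an arbitrary initial embedding of \<open>A\<^sub>0\<close>. The usual back-and-forth arguments
  for uniqueness and prehomogeneity become plays of two such strategies of Odd against each other.
\<close>

section \<open>Substructures and embeddings\<close>

text \<open>Amalgamation and universality produce embeddings, while chains and games consist of
  genuine inclusions. The bridge is \<open>realize_embedding\<close>: it replaces the target by a
  copy in which a given embedding becomes an inclusion, and it is used wherever an embedding has to
  become a legal move. Finite generation enters twice. An embedding is determined by its values on
  finitely many generators, hence the countability of embeddings into a countable structure; and a
  finitely generated substructure of a union lies in one stage of the chain. As \<open>F\<close> is
  not assumed hereditary, finitely generated substructures of a member of
  \<open>sigma_class S F\<close> are first enclosed in members of \<open>F\<close>. Weak injectivity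
  keeps only \<open>A\<close> fixed, not the larger \<open>B\<close>. This shapes the strategy of
  Odd: the embedding of his last move into \<open>G\<close> may have to be revised, and only its
  values on a smaller set are permanent.\<close>

lemma substructureD:
  assumes "substructure S A B"
  shows "is_structure S A" "is_structure S B" "carrier A \<subseteq> carrier B"
    and "\<And>f xs. fun_args S (carrier A) f xs \<Longrightarrow> fn A f xs = fn B f xs"
    and "\<And>r xs. rel_args S (carrier A) r xs \<Longrightarrow> rl A r xs = rl B r xs"
  using assms by (auto simp: substructure_def)

lemma embeddingD:
  assumes "embedding S h A B"
  shows "is_structure S A" "is_structure S B" "h ` carrier A \<subseteq> carrier B" "inj_on h (carrier A)"
    and "\<And>a. a \<in> carrier A \<Longrightarrow> h a \<in> carrier B"
    and "\<And>f xs. fun_args S (carrier A) f xs \<Longrightarrow> h (fn A f xs) = fn B f (map h xs)"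
    and "\<And>r xs. rel_args S (carrier A) r xs \<Longrightarrow> rl A r xs = rl B r (map h xs)"
  using assms by (auto simp: embedding_def)

lemma isomorphismD:
  assumes "isomorphism S h A B"
  shows "embedding S h A B" "h ` carrier A = carrier B"
  using assms by (auto simp: isomorphism_def)

lemma fun_args_mono: "fun_args S C f xs \<Longrightarrow> C \<subseteq> D \<Longrightarrow> fun_args S D f xs"
  by (auto simp: fun_args_def)

lemma rel_args_mono: "rel_args S C r xs \<Longrightarrow> C \<subseteq> D \<Longrightarrow> rel_args S D r xs"
  by (auto simp: rel_args_def)

lemma fun_args_image: "fun_args S C f xs \<Longrightarrow> h ` C \<subseteq> D \<Longrightarrow> fun_args S D f (map h xs)"
  by (auto simp: fun_args_def)

lemma rel_args_image: "rel_args S C r xs \<Longrightarrow> h ` C \<subseteq> D \<Longrightarrow> rel_args S D r (map h xs)"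
  by (auto simp: rel_args_def)

lemma fn_in_carrier: "is_structure S A \<Longrightarrow> fun_args S (carrier A) f xs \<Longrightarrow> fn A f xs \<in> carrier A"
  by (auto simp: is_structure_def)

lemma structure_eqI:
  assumes "is_structure S A" "is_structure S B" "carrier A = carrier B"
    and "\<And>f xs. fun_args S (carrier A) f xs \<Longrightarrow> fn A f xs = fn B f xs"
    and "\<And>r xs. rel_args S (carrier A) r xs \<Longrightarrow> rl A r xs = rl B r xs"
  shows "A = B"
proof -
  \<comment> \<open>Off the proper arguments both operations are \<open>undefined\<close> and all
    relations are false, so agreement on proper arguments is enough.\<close>
  have "fn A = fn B" using assms unfolding is_structure_def by (intro ext) metis
  moreover have "rl A = rl B" using assms unfolding is_structure_def by (intro ext) metis
  ultimately show ?thesis using assms(3) by (auto intro: fo_structure.equality)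
qed

lemma substructure_refl: "is_structure S A \<Longrightarrow> substructure S A A"
  by (auto simp: substructure_def)

lemma substructure_trans:
  assumes "substructure S A B" "substructure S B C"
  shows "substructure S A C"
  using assms fun_args_mono[of S "carrier A" _ _ "carrier B"] rel_args_mono[of S "carrier A" _ _ "carrier B"]
  unfolding substructure_def by (metis order_trans)

lemma substructure_of_carrier_subset:
  assumes "substructure S A M" "substructure S B M" "carrier A \<subseteq> carrier B"
  shows "substructure S A B"
  using assms fun_args_mono[of S "carrier A" _ _ "carrier B"] rel_args_mono[of S "carrier A" _ _ "carrier B"]
  unfolding substructure_def by metis

lemma embedding_iff_substructure: "embedding S (\<lambda>x. x) A B \<longleftrightarrow> substructure S A B"
  unfolding embedding_def substructure_def by (auto simp: inj_on_def)

lemma embedding_comp: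
  assumes f: "embedding S f A B" and g: "embedding S g B C"
  shows "embedding S (\<lambda>x. g (f x)) A C"
proof -
  have "inj_on (g \<circ> f) (carrier A)"
    using embeddingD(3,4)[OF f] embeddingD(4)[OF g] by (meson comp_inj_on inj_on_subset)
  moreover have "g (f (fn A u xs)) = fn C u (map (\<lambda>x. g (f x)) xs)"
    if "fun_args S (carrier A) u xs" for u xs
    using embeddingD(6)[OF f that] embeddingD(6)[OF g fun_args_image[OF that embeddingD(3)[OF f]]]
    by (simp add: o_def)
  moreover have "rl A u xs = rl C u (map (\<lambda>x. g (f x)) xs)"
    if "rel_args S (carrier A) u xs" for u xs
    using embeddingD(7)[OF f that] embeddingD(7)[OF g rel_args_image[OF that embeddingD(3)[OF f]]]
    by (simp add: o_def)
  ultimately show ?thesis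
    using embeddingD(1,5)[OF f] embeddingD(2,5)[OF g] by (auto simp: embedding_def o_def)
qed

lemma embedding_cong:
  assumes "embedding S f A B" "\<And>a. a \<in> carrier A \<Longrightarrow> g a = f a"
  shows "embedding S g A B"
proof -
  have "map g xs = map f xs" if "set xs \<subseteq> carrier A" for xs
    using that assms(2) by auto
  moreover have "g ` carrier A = f ` carrier A" "inj_on g (carrier A) = inj_on f (carrier A)"
    using assms(2) by (auto simp: inj_on_def)
  ultimately show ?thesis
    using assms fn_in_carrier[OF embeddingD(1)[OF assms(1)]]
    unfolding embedding_def fun_args_def rel_args_def by metis
qed

lemma embedding_restrict:
  assumes "embedding S f B C" "substructure S A B"
  shows "embedding S f A C"
  using embedding_comp[OF _ assms(1)] assms(2) by (simp add: embedding_iff_substructure[symmetric])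

lemma embedding_extend:
  assumes "embedding S f A B" "substructure S B C"
  shows "embedding S f A C"
  using embedding_comp[OF assms(1)] assms(2) by (simp add: embedding_iff_substructure[symmetric])

lemma embedding_corestrict:
  assumes "embedding S f A C" "substructure S B C" "f ` carrier A \<subseteq> carrier B"
  shows "embedding S f A B"
  using assms fun_args_image[of S "carrier A" _ _ f "carrier B"] rel_args_image[of S "carrier A" _ _ f "carrier B"]
  unfolding embedding_def substructure_def by metis

lemma isomorphism_inverse:
  assumes "isomorphism S f A B"
  shows "isomorphism S (inv_into (carrier A) f) B A"
proof -
  let ?g = "inv_into (carrier A) f"
  have e: "embedding S f A B" and im: "f ` carrier A = carrier B"
    using isomorphismD[OF assms] by auto
  note inj = embeddingD(4)[OF e]
  have gin: "?g ` carrier B = carrier A"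
    using inj im by (metis inv_into_image_cancel order_refl)
  have fg: "map f (map ?g xs) = xs" if "set xs \<subseteq> carrier B" for xs
    using that im by (induction xs) (auto simp: f_inv_into_f)
  have "?g (fn B u xs) = fn A u (map ?g xs)" if a: "fun_args S (carrier B) u xs" for u xs
  proof -
    have a': "fun_args S (carrier A) u (map ?g xs)" using fun_args_image[OF a equalityD1[OF gin]] .
    have "f (fn A u (map ?g xs)) = fn B u xs"
      using embeddingD(6)[OF e a'] fg a by (auto simp: fun_args_def)
    then show ?thesis
      using inj fn_in_carrier[OF embeddingD(1)[OF e] a'] by (metis inv_into_f_f)
  qed
  moreover have "rl B u xs = rl A u (map ?g xs)" if a: "rel_args S (carrier B) u xs" for u xs
  proof -
    have a': "rel_args S (carrier A) u (map ?g xs)" using rel_args_image[OF a equalityD1[OF gin]] .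
    then show ?thesis
      using embeddingD(7)[OF e a'] fg a by (auto simp: rel_args_def)
  qed
  ultimately show ?thesis
    using gin embeddingD[OF e] inj_on_inv_into[of "carrier B" f "carrier A"] im
    by (auto simp: isomorphism_def embedding_def)
qed

lemma isomorphism_comp:
  assumes "isomorphism S f A B" "isomorphism S g B C"
  shows "isomorphism S (\<lambda>x. g (f x)) A C"
  using assms embedding_comp[of S f A B g C] unfolding isomorphism_def by (metis image_image)

lemma isomorphic_sym: "isomorphic S A B \<Longrightarrow> isomorphic S B A"
  unfolding isomorphic_def using isomorphism_inverse by blast

lemma isomorphic_trans: "isomorphic S A B \<Longrightarrow> isomorphic S B C \<Longrightarrow> isomorphic S A C"
  unfolding isomorphic_def using isomorphism_comp by blast

section \<open>Copies of a structure along injections\<close>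

definition image_structure ::
  "('f, 'r) signature \<Rightarrow> ('a \<Rightarrow> 'a) \<Rightarrow> ('f, 'r, 'a) fo_structure \<Rightarrow> ('f, 'r, 'a) fo_structure" where
  "image_structure S h A =
     \<lparr> carrier = h ` carrier A,
       fn = (\<lambda>f xs. if fun_args S (h ` carrier A) f xs
                    then h (fn A f (map (inv_into (carrier A) h) xs)) else undefined),
       rl = (\<lambda>r xs. rel_args S (h ` carrier A) r xs \<and> rl A r (map (inv_into (carrier A) h) xs)) \<rparr>"

lemma carrier_image_structure [simp]: "carrier (image_structure S h A) = h ` carrier A"
  by (simp add: image_structure_def)

lemma isomorphism_image_structure:
  assumes A: "is_structure S A" and inj: "inj_on h (carrier A)"
  shows "isomorphism S h A (image_structure S h A)"
proof -
  have cancel: "map (inv_into (carrier A) h) (map h xs) = xs" if "set xs \<subseteq> carrier A" for xs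
    using that inj by (induction xs) auto
  have pull: "fun_args S (carrier A) f (map (inv_into (carrier A) h) xs)"
    if "fun_args S (h ` carrier A) f xs" for f xs
    using that by (rule fun_args_image) (use inj in auto)
  have "is_structure S (image_structure S h A)"
    using fn_in_carrier[OF A pull] by (auto simp: image_structure_def is_structure_def)
  moreover have "h (fn A f xs) = fn (image_structure S h A) f (map h xs)"
    if "fun_args S (carrier A) f xs" for f xs
    using that fun_args_image[OF that order_refl, of h] cancel[of xs]
    by (auto simp: image_structure_def fun_args_def)
  moreover have "rl A f xs = rl (image_structure S h A) f (map h xs)"
    if "rel_args S (carrier A) f xs" for f xs
    using that rel_args_image[OF that order_refl, of h] cancel[of xs]
    by (auto simp: image_structure_def rel_args_def)
  ultimately show ?thesis
    using A inj by (auto simp: isomorphism_def embedding_def)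
qed

lemma isomorphism_image_of_embedding:
  assumes "embedding S h A B"
  shows "isomorphism S h A (image_structure S h A)"
  using isomorphism_image_structure embeddingD(1,4)[OF assms] .

lemma substructure_image_structure:
  assumes e: "embedding S h A B"
  shows "substructure S (image_structure S h A) B"
proof -
  let ?I = "image_structure S h A" and ?g = "inv_into (carrier A) h"
  have iso: "isomorphism S ?g ?I A"
    using isomorphism_inverse[OF isomorphism_image_of_embedding[OF e]] .
  have "embedding S (\<lambda>x. h (?g x)) ?I B"
    using embedding_comp[OF isomorphismD(1)[OF iso] e] .
  then have "embedding S (\<lambda>x. x) ?I B"
    by (rule embedding_cong) (simp add: f_inv_into_f)
  then show ?thesis by (simp add: embedding_iff_substructure)
qed

section \<open>Closed subsets, generators and counting embeddings\<close>

definition restriction ::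
  "('f, 'r) signature \<Rightarrow> 'a set \<Rightarrow> ('f, 'r, 'a) fo_structure \<Rightarrow> ('f, 'r, 'a) fo_structure" where
  "restriction S C A =
     \<lparr> carrier = C,
       fn = (\<lambda>f xs. if fun_args S C f xs then fn A f xs else undefined),
       rl = (\<lambda>r xs. rel_args S C r xs \<and> rl A r xs) \<rparr>"

lemma carrier_restriction [simp]: "carrier (restriction S C A) = C"
  by (simp add: restriction_def)

lemma substructure_restriction:
  assumes "is_structure S A" "C \<subseteq> carrier A"
    and "\<And>f xs. fun_args S C f xs \<Longrightarrow> fn A f xs \<in> C"
  shows "substructure S (restriction S C A) A"
  using assms by (auto simp: substructure_def is_structure_def restriction_def)

text \<open>Phrased with closed subsets instead of substructures, so that a set such as an equalizer
  or an intersection can be tested without making it a structure.\<close>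

definition generates :: "('f, 'r) signature \<Rightarrow> 'a set \<Rightarrow> ('f, 'r, 'a) fo_structure \<Rightarrow> bool" where
  "generates S G A \<longleftrightarrow> G \<subseteq> carrier A \<and>
     (\<forall>C. G \<subseteq> C \<and> C \<subseteq> carrier A \<and> (\<forall>f xs. fun_args S C f xs \<longrightarrow> fn A f xs \<in> C) \<longrightarrow> C = carrier A)"

lemma generatesD:
  assumes "generates S G A" "G \<subseteq> C" "C \<subseteq> carrier A" "\<And>f xs. fun_args S C f xs \<Longrightarrow> fn A f xs \<in> C"
  shows "C = carrier A"
  using assms unfolding generates_def by blast

lemma finitely_generated_generators:
  assumes "finitely_generated S A"
  obtains G where "finite G" "generates S G A"
proof -
  obtain G where G: "finite G" "G \<subseteq> carrier A"
      "\<And>B. substructure S B A \<Longrightarrow> G \<subseteq> carrier B \<Longrightarrow> B = A"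
    and A: "is_structure S A"
    using assms unfolding finitely_generated_def by blast
  have "C = carrier A"
    if "G \<subseteq> C" "C \<subseteq> carrier A" "\<forall>f xs. fun_args S C f xs \<longrightarrow> fn A f xs \<in> C" for C
  proof -
    have "restriction S C A = A"
      using G(3)[OF substructure_restriction[OF A that(2)]] that(1,3) by simp
    then have "carrier (restriction S C A) = carrier A" by (rule arg_cong)
    then show ?thesis by simp
  qed
  then have "generates S G A" using G(2) unfolding generates_def by blast
  then show ?thesis using that G(1) by blast
qed

text \<open>An embedding is determined by the list of its values on finitely many generators, and
  there are only countably many finite lists over \<open>carrier M\<close>.\<close>

lemma countable_embeddings:
  assumes fg: "finitely_generated S A" and "countable (carrier M)"
  obtains E :: "nat \<Rightarrow> 'a \<Rightarrow> 'a" where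
    "\<And>h. embedding S h A M \<Longrightarrow> \<exists>n. \<forall>a\<in>carrier A. h a = E n a"
proof -
  obtain G where "finite G" and gen: "generates S G A"
    using finitely_generated_generators[OF fg] .
  then have G: "finite G" "G \<subseteq> carrier A" by (auto simp: generates_def)
  obtain gs where gs: "set gs = G" using finite_list[OF G(1)] by blast
  have agree: "h a = k a" if h: "embedding S h A M" and k: "embedding S k A M"
    and hk: "map h gs = map k gs" and a: "a \<in> carrier A" for h k a
  proof -
    \<comment> \<open>The equalizer of two embeddings is closed under the operations and contains
      the generators.\<close>
    have "{a \<in> carrier A. h a = k a} = carrier A"
    proof (rule generatesD[OF gen])
      show "G \<subseteq> {a \<in> carrier A. h a = k a}"
        using hk G(2) by (auto simp flip: gs)
      fix f xs assume xs: "fun_args S {a \<in> carrier A. h a = k a} f xs"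
      then have xs': "fun_args S (carrier A) f xs" by (rule fun_args_mono) auto
      have eq: "map h xs = map k xs" using xs by (auto simp: fun_args_def)
      show "fn A f xs \<in> {a \<in> carrier A. h a = k a}"
        using fn_in_carrier[OF embeddingD(1)[OF h] xs']
        by (simp only: mem_Collect_eq embeddingD(6)[OF h xs'] embeddingD(6)[OF k xs'] eq)
    qed auto
    then show ?thesis using a by auto
  qed
  let ?R = "(\<lambda>h. map h gs) ` {h. embedding S h A M}"
  have "h x \<in> carrier M" if "embedding S h A M" "x \<in> G" for h x
    using embeddingD(5)[OF that(1)] that(2) G(2) by blast
  then have "?R \<subseteq> lists (carrier M)" using gs by auto
  then have cR: "countable ?R"
    using countable_lists[OF assms(2)] by (metis countable_subset)
  \<comment> \<open>If there is no embedding at all, \<open>E n\<close> is an arbitrary function;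
    only the coverage of all embeddings is claimed.\<close>
  define E where "E n = (SOME h. embedding S h A M \<and> map h gs = from_nat_into ?R n)" for n
  have "\<exists>n. \<forall>a\<in>carrier A. h a = E n a" if h: "embedding S h A M" for h
  proof -
    obtain n where n: "from_nat_into ?R n = map h gs"
      using from_nat_into_surj[OF cR, of "map h gs"] h by auto
    then have "embedding S (E n) A M \<and> map (E n) gs = map h gs"
      unfolding E_def n using someI[of "\<lambda>k. embedding S k A M \<and> map k gs = map h gs" h] h by simp
    then have "h a = E n a" if "a \<in> carrier A" for a using agree[OF h _ _ that, of "E n"] by simp
    then show ?thesis by blast
  qed
  then show ?thesis using that by blast
qed

text \<open>This is where an uncountable ambient type is needed: there is room for the new elements.\<close>

lemma realize_embedding:
  fixes A X :: "('f, 'r, 'a) fo_structure"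
  assumes unc: "uncountable (UNIV :: 'a set)"
    and f: "embedding S f A X" and cA: "countable (carrier A)" and cX: "countable (carrier X)"
  obtains X' i where "isomorphism S i X X'" "substructure S A X'" "\<And>a. a \<in> carrier A \<Longrightarrow> i (f a) = a"
proof -
  let ?D = "carrier X - f ` carrier A"
  have "infinite (- carrier A)"
    using unc cA by (metis Compl_eq_Diff_UNIV uncountable_minus_countable uncountable_infinite)
  then obtain k :: "nat \<Rightarrow> 'a" where k: "inj k" "range k \<subseteq> - carrier A"
    using infinite_countable_subset by blast
  obtain t :: "'a \<Rightarrow> nat" where t: "inj_on t ?D"
    using cX by (metis countableE countable_Diff)
  \<comment> \<open>\<open>i\<close> undoes \<open>f\<close> on its image and sends the remaining
    elements of \<open>X\<close>, coded by \<open>t\<close>, injectively to new points outside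
    \<open>carrier A\<close>.\<close>
  define i where "i x = (if x \<in> f ` carrier A then inv_into (carrier A) f x else k (t x))" for x
  have if_: "i (f a) = a" if "a \<in> carrier A" for a
    using that embeddingD(4)[OF f] by (simp add: i_def)
  have "inj_on i (carrier X)"
  proof (rule inj_onI)
    fix x y assume xy: "x \<in> carrier X" "y \<in> carrier X" "i x = i y"
    have in1: "i z \<in> carrier A" if "z \<in> f ` carrier A" for z using that if_ by auto
    have in2: "i z \<notin> carrier A" if "z \<notin> f ` carrier A" for z using that k(2) by (auto simp: i_def)
    show "x = y"
    proof (cases "x \<in> f ` carrier A")
      case True
      then have "y \<in> f ` carrier A" using in1 in2 xy by metis
      then show ?thesis using True xy(3) if_ by auto
    next
      case False
      then have "y \<notin> f ` carrier A" using in1 in2 xy by metis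
      then show ?thesis using False xy t k(1) by (auto simp: i_def inj_on_def)
    qed
  qed
  then have iso: "isomorphism S i X (image_structure S i X)"
    using isomorphism_image_structure embeddingD(2)[OF f] by blast
  have "embedding S (\<lambda>a. i (f a)) A (image_structure S i X)"
    using embedding_comp[OF f isomorphismD(1)[OF iso]] .
  then have "embedding S (\<lambda>a. a) A (image_structure S i X)"
    by (rule embedding_cong) (simp add: if_)
  then show ?thesis using that iso if_ by (simp add: embedding_iff_substructure)
qed

section \<open>Unions of chains\<close>

lemma chain_inD:
  assumes "chain_in S F X"
  shows "X n \<in> F" "substructure S (X n) (X (Suc n))" "is_structure S (X n)"
  using assms by (auto simp: chain_in_def substructure_def)

lemma chain_in_mono:
  assumes "chain_in S F X" "m \<le> n"
  shows "substructure S (X m) (X n)"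
  using assms(2)
proof (induction n rule: dec_induct)
  case base then show ?case using chain_inD(3)[OF assms(1)] by (rule substructure_refl)
next
  case (step n) then show ?case using chain_inD(2)[OF assms(1)] substructure_trans by blast
qed

lemma carrier_chain_union [simp]: "carrier (chain_union S X) = (\<Union>n. carrier (X n))"
  by (simp add: chain_union_def)

lemma finite_subset_chain:
  assumes ch: "chain_in S F X" and "finite G" "G \<subseteq> (\<Union>n. carrier (X n))"
  obtains n where "G \<subseteq> carrier (X n)"
proof -
  have "\<exists>n. G \<subseteq> carrier (X n)" using assms(2,3)
  proof (induction G)
    case (insert a G)
    then obtain n m where "G \<subseteq> carrier (X n)" "a \<in> carrier (X m)" by auto
    then have "insert a G \<subseteq> carrier (X (max n m))"
      using substructureD(3)[OF chain_in_mono[OF ch]] by (metis insert_subset max.cobounded1 max.cobounded2 subset_trans subsetD)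
    then show ?case by blast
  qed auto
  then show ?thesis using that by blast
qed

lemma fun_args_chain:
  assumes "chain_in S F X" "fun_args S (\<Union>n. carrier (X n)) f xs"
  shows "\<exists>n. fun_args S (carrier (X n)) f xs"
  using finite_subset_chain[OF assms(1) finite_set, of xs] assms(2) unfolding fun_args_def by metis

lemma rel_args_chain:
  assumes "chain_in S F X" "rel_args S (\<Union>n. carrier (X n)) r xs"
  shows "\<exists>n. rel_args S (carrier (X n)) r xs"
  using finite_subset_chain[OF assms(1) finite_set, of xs] assms(2) unfolding rel_args_def by metis

lemma substructure_chain_union:
  assumes ch: "chain_in S F X"
  shows "substructure S (X n) (chain_union S X)"
proof -
  let ?U = "\<Union>n. carrier (X n)"
  have fn_eq: "fn (chain_union S X) f xs = fn (X n) f xs" if xs: "fun_args S (carrier (X n)) f xs" for n f xs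
  proof -
    let ?l = "LEAST n. set xs \<subseteq> carrier (X n)"
    have "set xs \<subseteq> carrier (X n)" using xs by (simp add: fun_args_def)
    then have l: "set xs \<subseteq> carrier (X ?l)" "?l \<le> n" by (rule LeastI, rule Least_le)
    then have "fun_args S (carrier (X ?l)) f xs" using xs by (simp add: fun_args_def)
    then have "fn (X ?l) f xs = fn (X n) f xs"
      using substructureD(4)[OF chain_in_mono[OF ch l(2)]] by blast
    moreover have "fun_args S ?U f xs" using xs by (auto simp: fun_args_def)
    ultimately show ?thesis by (simp add: chain_union_def)
  qed
  have rl_eq: "rl (chain_union S X) r xs = rl (X n) r xs" if xs: "rel_args S (carrier (X n)) r xs" for n r xs
  proof -
    have "rl (X n) r xs" if m: "rl (X m) r xs" for m
    proof -
      have am: "rel_args S (carrier (X m)) r xs" using m chain_inD(3)[OF ch] by (auto simp: is_structure_def)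
      have "rl (X (max m n)) r xs"
        using m substructureD(5)[OF chain_in_mono[OF ch max.cobounded1] am] by blast
      then show ?thesis
        using substructureD(5)[OF chain_in_mono[OF ch max.cobounded2] xs] by blast
    qed
    then show ?thesis by (auto simp: chain_union_def)
  qed
  have "is_structure S (chain_union S X)"
    unfolding is_structure_def
  proof (intro conjI allI impI)
    fix f xs assume "fun_args S (carrier (chain_union S X)) f xs"
    then obtain n where n: "fun_args S (carrier (X n)) f xs" using fun_args_chain[OF ch] by auto
    show "fn (chain_union S X) f xs \<in> carrier (chain_union S X)"
      using fn_eq[OF n] fn_in_carrier[OF chain_inD(3)[OF ch] n] by auto
  next
    fix f xs assume "\<not> fun_args S (carrier (chain_union S X)) f xs"
    then show "fn (chain_union S X) f xs = undefined" by (simp add: chain_union_def)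
  next
    fix r xs assume "rl (chain_union S X) r xs"
    then obtain n where "rl (X n) r xs" by (auto simp: chain_union_def)
    then have "rel_args S (carrier (X n)) r xs" using chain_inD(3)[OF ch] by (auto simp: is_structure_def)
    then show "rel_args S (carrier (chain_union S X)) r xs" by (auto simp: rel_args_def)
  qed
  then show ?thesis
    using chain_inD(3)[OF ch] fn_eq rl_eq by (auto simp: substructure_def)
qed

lemma embedding_chain_union:
  assumes ch: "chain_in S F X" and h: "\<And>n. embedding S h (X n) N"
  shows "embedding S h (chain_union S X) N"
proof -
  let ?U = "\<Union>n. carrier (X n)"
  note sub = substructure_chain_union[OF ch]
  have "inj_on h ?U"
  proof (rule inj_onI)
    fix x y assume xy: "x \<in> ?U" "y \<in> ?U" "h x = h y"
    then obtain n where "{x, y} \<subseteq> carrier (X n)" using finite_subset_chain[OF ch, of "{x, y}"] by auto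
    then show "x = y" using embeddingD(4)[OF h] xy(3) by (auto simp: inj_on_def)
  qed
  moreover have "h (fn (chain_union S X) f xs) = fn N f (map h xs)" if xs: "fun_args S ?U f xs" for f xs
  proof -
    obtain n where "fun_args S (carrier (X n)) f xs"
      using fun_args_chain[OF ch xs] by blast
    then show ?thesis using embeddingD(6)[OF h] substructureD(4)[OF sub] by metis
  qed
  moreover have "rl (chain_union S X) r xs = rl N r (map h xs)" if xs: "rel_args S ?U r xs" for r xs
  proof -
    obtain n where "rel_args S (carrier (X n)) r xs"
      using rel_args_chain[OF ch xs] by blast
    then show ?thesis using embeddingD(7)[OF h] substructureD(5)[OF sub] by metis
  qed
  ultimately show ?thesis
    using substructureD(2)[OF sub] embeddingD(2,5)[OF h] by (auto simp: embedding_def)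
qed

lemma finitely_generated_substructure_chain_union:
  assumes ch: "chain_in S F X" and fg: "finitely_generated S A" and A: "substructure S A (chain_union S X)"
  obtains n where "substructure S A (X n)"
proof -
  obtain G where "finite G" and gen: "generates S G A"
    using finitely_generated_generators[OF fg] .
  then have G: "finite G" "G \<subseteq> carrier A" by (auto simp: generates_def)
  have "G \<subseteq> (\<Union>n. carrier (X n))" using G(2) substructureD(3)[OF A] by auto
  then obtain n where n: "G \<subseteq> carrier (X n)" using finite_subset_chain[OF ch G(1)] by blast
  note sub = substructure_chain_union[OF ch, of n]
  \<comment> \<open>Once a stage contains the generators, its intersection with \<open>A\<close> is
    a closed set containing them.\<close>
  have "carrier A \<inter> carrier (X n) = carrier A"
  proof (rule generatesD[OF gen])
    fix f xs assume xs: "fun_args S (carrier A \<inter> carrier (X n)) f xs"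
    have 1: "fun_args S (carrier A) f xs" and 2: "fun_args S (carrier (X n)) f xs"
      using fun_args_mono[OF xs] by auto
    then show "fn A f xs \<in> carrier A \<inter> carrier (X n)"
      using substructureD(4)[OF A 1] substructureD(4)[OF sub 2]
        fn_in_carrier[OF substructureD(1)[OF A] 1] fn_in_carrier[OF substructureD(1)[OF sub] 2] by auto
  qed (use G n in auto)
  then show ?thesis using that substructure_of_carrier_subset[OF A sub] by blast
qed

text \<open>Dropping the opening move does not change the result of a play; this lets one play be
  read as two plays with the roles of the players exchanged.\<close>

lemma chain_union_shift:
  assumes ch: "chain_in S F X"
  shows "chain_union S (\<lambda>n. X (Suc n)) = chain_union S X"
proof -
  have ch': "chain_in S F (\<lambda>n. X (Suc n))" using ch by (simp add: chain_in_def)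
  note s = substructure_chain_union[OF ch] and s' = substructure_chain_union[OF ch']
  have "carrier (X 0) \<subseteq> carrier (X (Suc 0))" using substructureD(3)[OF chain_inD(2)[OF ch]] .
  then have car: "(\<Union>n. carrier (X (Suc n))) = (\<Union>n. carrier (X n))"
    by (auto simp: set_eq_iff) (metis not0_implies_Suc subsetD)
  show ?thesis
  proof (rule structure_eqI)
    fix f xs assume "fun_args S (carrier (chain_union S (\<lambda>n. X (Suc n)))) f xs"
    then obtain n where "fun_args S (carrier (X (Suc n))) f xs" using fun_args_chain[OF ch'] by auto
    then show "fn (chain_union S (\<lambda>n. X (Suc n))) f xs = fn (chain_union S X) f xs"
      using substructureD(4)[OF s] substructureD(4)[OF s'] by metis
  next
    fix f xs assume "rel_args S (carrier (chain_union S (\<lambda>n. X (Suc n)))) f xs"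
    then obtain n where "rel_args S (carrier (X (Suc n))) f xs" using rel_args_chain[OF ch'] by auto
    then show "rl (chain_union S (\<lambda>n. X (Suc n))) f xs = rl (chain_union S X) f xs"
      using substructureD(5)[OF s] substructureD(5)[OF s'] by metis
  qed (use substructureD(2)[OF s] substructureD(2)[OF s'] car in auto)
qed

section \<open>Plays and strategies\<close>

primrec history :: "('s list \<Rightarrow> 's) \<Rightarrow> nat \<Rightarrow> 's list" where
  "history t 0 = []"
| "history t (Suc n) = history t n @ [t (history t n)]"

text \<open>Course-of-values recursion: each move depends on the list of all earlier ones, and
  \<open>history\<close> builds that list.\<close>

lemma play_exists: "\<exists>A. \<forall>n. A n = t (map A [0..<n])"
proof -
  have "map (\<lambda>n. t (history t n)) [0..<n] = history t n" for n by (induction n) auto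
  then show ?thesis by (intro exI[of _ "\<lambda>n. t (history t n)"]) simp
qed

lemma position_Nil [simp]: "position S F []"
  by (simp add: position_def)

lemma position_snoc:
  "position S F (p @ [x]) \<longleftrightarrow> position S F p \<and> x \<in> F \<and> (p \<noteq> [] \<longrightarrow> substructure S (last p) x)"
proof (cases p rule: rev_cases)
  case (snoc q y)
  have "(\<forall>i. Suc i < Suc (Suc (length q)) \<longrightarrow> substructure S ((q @ [y, x]) ! i) ((q @ [y, x]) ! Suc i)) \<longleftrightarrow>
        (\<forall>i. Suc i < Suc (length q) \<longrightarrow> substructure S ((q @ [y]) ! i) ((q @ [y]) ! Suc i)) \<and> substructure S y x"
    by (auto simp: nth_append less_Suc_eq)
  then show ?thesis using snoc by (auto simp: position_def)
qed (auto simp: position_def)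

lemma position_tl: "position S F p \<Longrightarrow> position S F (tl p)"
  by (cases p) (auto simp: position_def)

lemma chain_in_iff_positions: "chain_in S F A \<longleftrightarrow> (\<forall>n. position S F (map A [0..<n]))"
proof
  assume "chain_in S F A"
  then show "\<forall>n. position S F (map A [0..<n])" by (auto simp: chain_in_def position_def)
next
  assume p: "\<forall>n. position S F (map A [0..<n])"
  show "chain_in S F A"
    unfolding chain_in_def
  proof
    fix n
    have "position S F (map A [0..<n] @ [A n])" "position S F ((map A [0..<n] @ [A n]) @ [A (Suc n)])"
      using p[rule_format, of "Suc n"] p[rule_format, of "Suc (Suc n)"] by simp_all
    then show "A n \<in> F \<and> substructure S (A n) (A (Suc n))"
      unfolding position_snoc by simp
  qed
qed

lemma chain_in_of_strategies:
  assumes "strategy S F Eve e" "strategy S F Odd d" "follows Eve e A" "follows Odd d A"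
  shows "chain_in S F A"
proof -
  have "position S F (map A [0..<n])" for n
  proof (induction n)
    case (Suc n)
    then show ?case using assms unfolding strategy_def follows_def
      by (cases "even n") (auto dest!: spec[of _ n] spec[of _ "map A [0..<n]"])
  qed simp
  then show ?thesis by (simp add: chain_in_iff_positions)
qed

lemma play_of_strategies:
  assumes "strategy S F Eve e" "strategy S F Odd d"
  obtains A where "chain_in S F A" "follows Eve e A" "follows Odd d A"
proof -
  obtain A where A: "\<And>n. A n = (\<lambda>p. if even (length p) then e p else d p) (map A [0..<n])"
    using play_exists[of "\<lambda>p. if even (length p) then e p else d p"] by blast
  have "follows Eve e A" "follows Odd d A"
    unfolding follows_def by (auto simp: A[of n for n])
  then show ?thesis using that chain_in_of_strategies[OF assms] by blast
qed

text \<open>Each Odd strategy regards the opponent's moves as Eve's; for the second one, Eve begins with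
  the move \<open>A 1\<close>.\<close>

lemma merge_odd_strategies:
  assumes s1: "strategy S F Odd s1" and s2: "strategy S F Odd s2" and "Z \<in> F"
  obtains A where "chain_in S F A" "A 0 = Z" "follows Odd s1 A"
    "chain_in S F (\<lambda>n. A (Suc n))" "follows Odd s2 (\<lambda>n. A (Suc n))"
proof -
  \<comment> \<open>Eve opens with \<open>Z\<close> and then answers as \<open>s2\<close> would if
    the opening move had not been made; at her later positions \<open>tl p\<close> has odd length,
    so there \<open>s2\<close> is indeed to move.\<close>
  let ?e = "\<lambda>p. if p = [] then Z else s2 (tl p)"
  have "strategy S F Eve ?e"
    unfolding strategy_def
  proof (intro allI impI)
    fix p assume p: "position S F p \<and> to_move Eve (length p)"
    show "position S F (p @ [?e p])"
    proof (cases "p = []")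
      case True
      then show ?thesis using \<open>Z \<in> F\<close> by (simp add: position_snoc[of S F "[]", simplified])
    next
      case False
      then have odd: "odd (length (tl p))" using p by simp
      then have "tl p \<noteq> []" by (metis even_zero list.size(3))
      then show ?thesis
        using s2 odd p position_tl[of S F p] False unfolding strategy_def
        by (auto simp: position_snoc last_tl)
    qed
  qed
  then obtain A where A: "chain_in S F A" "follows Eve ?e A" "follows Odd s1 A"
    using play_of_strategies s1 by blast
  have "A 0 = Z" using A(2) by (auto simp: follows_def)
  moreover have "chain_in S F (\<lambda>n. A (Suc n))" using A(1) by (simp add: chain_in_def)
  moreover have "follows Odd s2 (\<lambda>n. A (Suc n))"
    unfolding follows_def
  proof (intro allI impI)
    fix n assume "to_move Odd n"
    then have "A (Suc n) = ?e (map A [0..<Suc n])"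
      using A(2) unfolding follows_def by (metis even_Suc to_move.simps)
    then show "A (Suc n) = s2 (map (\<lambda>n. A (Suc n)) [0..<n])" by (simp add: map_upt_Suc del: upt_Suc)
  qed
  ultimately show ?thesis using that A by blast
qed

section \<open>Classes of finitely generated structures\<close>

locale fraisse_class =
  fixes S :: "('f, 'r) signature" and F :: "('f, 'r, 'a) fo_structure set"
  assumes uncountable_type: "uncountable (UNIV :: 'a set)"
    and fg_class: "fg_class S F"
    and nonempty: "F \<noteq> {}"
begin

section \<open>Closure properties of the class and of its unions of chains\<close>

lemma class_iso_closed: "A \<in> F \<Longrightarrow> isomorphism S h A B \<Longrightarrow> B \<in> F"
  using fg_class unfolding fg_class_def isomorphic_def by blast

lemma class_countable: "A \<in> F \<Longrightarrow> countable (carrier A)"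
  and class_finitely_generated: "A \<in> F \<Longrightarrow> finitely_generated S A"
  using fg_class by (auto simp: fg_class_def)

lemma class_structure: "A \<in> F \<Longrightarrow> is_structure S A"
  using class_finitely_generated by (auto simp: finitely_generated_def)

lemma class_refl: "A \<in> F \<Longrightarrow> substructure S A A"
  by (rule substructure_refl[OF class_structure])

lemma class_image:
  assumes "A \<in> F" "embedding S h A B"
  shows "image_structure S h A \<in> F" "substructure S (image_structure S h A) B"
  using class_iso_closed[OF assms(1) isomorphism_image_of_embedding[OF assms(2)]]
    substructure_image_structure[OF assms(2)] .

text \<open>Closure of \<open>F\<close> under isomorphisms keeps the relocated copy in the class,
  which makes it available as a move.\<close>

lemma realize_in_class:
  assumes "A \<in> F" "X \<in> F" "embedding S f A X"
  obtains X' i where "X' \<in> F" "isomorphism S i X X'" "substructure S A X'"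
    "\<And>a. a \<in> carrier A \<Longrightarrow> i (f a) = a"
  using realize_embedding[OF uncountable_type assms(3)] class_countable assms class_iso_closed by metis

lemma sigma_countable: "G \<in> sigma_class S F \<Longrightarrow> countable (carrier G)"
  using class_countable by (auto simp: sigma_class_def chain_in_def)

text \<open>Each of \<open>A\<close> and \<open>B\<close> lies in one stage of a chain with union
  \<open>G\<close>; the later of the two stages serves as \<open>C\<close>. Neither \<open>A\<close>
  nor \<open>B\<close> has to belong to \<open>F\<close>.\<close>

lemma sigma_absorb:
  assumes G: "G \<in> sigma_class S F" and A: "finitely_generated S A" "substructure S A G"
    and B: "finitely_generated S B" "substructure S B G"
  obtains C where "C \<in> F" "substructure S A C" "substructure S B C" "substructure S C G"
proof -
  obtain X where ch: "chain_in S F X" and X: "G = chain_union S X"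
    using G by (auto simp: sigma_class_def)
  obtain m where m: "substructure S A (X m)"
    using finitely_generated_substructure_chain_union[OF ch A(1)] A(2) X by blast
  obtain n where n: "substructure S B (X n)"
    using finitely_generated_substructure_chain_union[OF ch B(1)] B(2) X by blast
  show ?thesis
    using that[of "X (max m n)"] substructure_trans[OF m chain_in_mono[OF ch max.cobounded1]]
      substructure_trans[OF n chain_in_mono[OF ch max.cobounded2]]
      substructure_chain_union[OF ch] chain_inD(1)[OF ch] X by blast
qed

text \<open>The implication about \<open>u\<close> allows points outside \<open>G\<close>: a
  sequence that is to enumerate an empty carrier cannot stay inside it.\<close>

lemma sigma_absorb_point:
  assumes G: "G \<in> sigma_class S F" and A: "A \<in> F" "substructure S A G"
  obtains C where "C \<in> F" "substructure S A C" "substructure S C G" "u \<in> carrier G \<longrightarrow> u \<in> carrier C"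
proof (cases "u \<in> carrier G")
  case True
  obtain X where ch: "chain_in S F X" and X: "G = chain_union S X"
    using G by (auto simp: sigma_class_def)
  obtain n where n: "u \<in> carrier (X n)" using True X by auto
  obtain C where C: "C \<in> F" "substructure S A C" "substructure S (X n) C" "substructure S C G"
    using sigma_absorb[OF G class_finitely_generated[OF A(1)] A(2)
        class_finitely_generated[OF chain_inD(1)[OF ch]]] substructure_chain_union[OF ch] X by blast
  show ?thesis using that[OF C(1,2,4)] n substructureD(3)[OF C(3)] by blast
next
  case False
  then show ?thesis using that[OF A(1) class_refl[OF A(1)] A(2)] by blast
qed

text \<open>A strategy must be legal at every position, including those that no play following it
  reaches. An arbitrary rule is therefore patched: where it proposes an illegal move, the last move
  is repeated, or any member of \<open>F\<close> is played at the start.\<close>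

definition make_legal ::
  "(('f, 'r, 'a) fo_structure list \<Rightarrow> ('f, 'r, 'a) fo_structure) \<Rightarrow>
   ('f, 'r, 'a) fo_structure list \<Rightarrow> ('f, 'r, 'a) fo_structure" where
  "make_legal s p = (if position S F (p @ [s p]) then s p
                     else if p = [] then (SOME A. A \<in> F) else last p)"

lemma strategy_make_legal: "strategy S F P (make_legal s)"
  unfolding strategy_def
proof (intro allI impI)
  fix p assume p: "position S F p \<and> to_move P (length p)"
  have "last p \<in> F" if "p \<noteq> []" using p that by (auto simp: position_def)
  then show "position S F (p @ [make_legal s p])"
    using p class_refl nonempty by (auto simp: make_legal_def position_snoc some_in_eq)
qed

lemma make_legal_eq:
  assumes "position S F p" "s p \<in> F" "p \<noteq> [] \<Longrightarrow> substructure S (last p) (s p)"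
  shows "make_legal s p = s p"
  using assms by (simp add: make_legal_def position_snoc)

text \<open>Since a strategy sees all previous moves, it may carry a state along, to be updated after each
  round; \<open>J n st A\<close> says that \<open>A\<close> is a possible move of Eve in round \<open>n\<close> in the state \<open>st\<close>.\<close>

lemma odd_strategy_from_states:
  fixes J :: "nat \<Rightarrow> 's \<Rightarrow> ('f, 'r, 'a) fo_structure \<Rightarrow> bool"
  assumes init: "\<And>A. A \<in> F \<Longrightarrow> J 0 st0 A"
    and step: "\<And>n st A. A \<in> F \<Longrightarrow> J n st A \<Longrightarrow>
      \<exists>A' st'. A' \<in> F \<and> substructure S A A' \<and> R n st A A' st' \<and> (\<forall>X\<in>F. substructure S A' X \<longrightarrow> J (Suc n) st' X)"
  obtains s where "strategy S F Odd s"
    "\<And>A. chain_in S F A \<Longrightarrow> follows Odd s A \<Longrightarrow>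
       \<exists>st. \<forall>n. R n (st n) (A (2 * n)) (A (Suc (2 * n))) (st (Suc n))"
proof -
  have "\<forall>n st A. \<exists>q. A \<in> F \<and> J n st A \<longrightarrow> fst q \<in> F \<and> substructure S A (fst q) \<and>
      R n st A (fst q) (snd q) \<and> (\<forall>X\<in>F. substructure S (fst q) X \<longrightarrow> J (Suc n) (snd q) X)"
    using step by (metis fst_conv snd_conv)
  then obtain sk where sk: "\<And>n st A. A \<in> F \<Longrightarrow> J n st A \<Longrightarrow> fst (sk n st A) \<in> F \<and> substructure S A (fst (sk n st A)) \<and>
      R n st A (fst (sk n st A)) (snd (sk n st A)) \<and>
      (\<forall>X\<in>F. substructure S (fst (sk n st A)) X \<longrightarrow> J (Suc n) (snd (sk n st A)) X)"
    by metis
  \<comment> \<open>The state is not stored but recomputed from Eve's moves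
    \<open>A (2 * k)\<close>, so the state of round \<open>n\<close> depends only on the first
    \<open>2 * n\<close> moves.\<close>
  define state where "state A = rec_nat st0 (\<lambda>k st. snd (sk k st (A (2 * k))))" for A
  have state_Suc: "state A (Suc n) = snd (sk n (state A n) (A (2 * n)))" for A n
    by (simp add: state_def)
  have state_cong: "state A n = state B n" if "\<And>i. i < 2 * n \<Longrightarrow> A i = B i" for A B n
    using that by (induction n) (auto simp: state_def)
  \<comment> \<open>At a position of Odd the length is \<open>2 * k + 1\<close>, where
    \<open>k\<close> is the number of the round and \<open>p ! (2 * k)\<close> is Eve's latest
    move.\<close>
  define c where "c p = (let k = length p div 2 in fst (sk k (state (nth p) k) (p ! (2 * k))))" for p
  have "\<exists>st. \<forall>n. R n (st n) (A (2 * n)) (A (Suc (2 * n))) (st (Suc n))"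
    if ch: "chain_in S F A" and fol: "follows Odd (make_legal c) A" for A
  proof -
    have round: "A (Suc (2 * n)) = fst (sk n (state A n) (A (2 * n)))" if J: "J n (state A n) (A (2 * n))" for n
    proof -
      let ?p = "map A [0..<Suc (2 * n)]"
      have "state (nth ?p) n = state A n"
        by (rule state_cong) (simp add: nth_append)
      moreover have "length ?p div 2 = n" "?p ! (2 * n) = A (2 * n)" by (auto simp: nth_append)
      ultimately have c: "c ?p = fst (sk n (state A n) (A (2 * n)))" unfolding c_def Let_def by presburger
      have "A (Suc (2 * n)) = make_legal c ?p"
        using fol by (auto simp: follows_def simp del: upt_Suc)
      also have "\<dots> = c ?p"
      proof (rule make_legal_eq)
        show "position S F ?p" using ch by (simp add: chain_in_iff_positions del: upt_Suc)
        show "c ?p \<in> F" "substructure S (last ?p) (c ?p)"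
          unfolding c using sk[OF chain_inD(1)[OF ch] J] by auto
      qed
      finally show ?thesis using c by simp
    qed
    \<comment> \<open>\<open>J\<close> makes the rule's move legal, so that
      \<open>make_legal\<close> does not alter it; this move in turn secures \<open>J\<close> for
      whatever Eve answers.\<close>
    have J: "J n (state A n) (A (2 * n))" for n
    proof (induction n)
      case 0
      then show ?case using init chain_inD(1)[OF ch] by (simp add: state_def)
    next
      case (Suc n)
      then show ?case
        using sk[OF chain_inD(1)[OF ch] Suc] round[OF Suc] chain_inD(1)[OF ch, of "Suc (Suc (2 * n))"]
          chain_inD(2)[OF ch, of "Suc (2 * n)"] by (simp add: state_Suc)
    qed
    then have "R n (state A n) (A (2 * n)) (A (Suc (2 * n))) (state A (Suc n))" for n
      using sk[OF chain_inD(1)[OF ch] J] round by (simp add: state_Suc)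
    then show ?thesis by blast
  qed
  then show ?thesis using that strategy_make_legal by blast
qed

section \<open>Weakly injective structures\<close>

lemma weakly_injective_universal: "weakly_injective S F G \<Longrightarrow> universal S F G"
  by (simp add: weakly_injective_def)

lemma weakly_injective_sigma: "weakly_injective S F G \<Longrightarrow> G \<in> sigma_class S F"
  by (simp add: weakly_injective_def universal_def)

lemma weakly_injective_embeds: "weakly_injective S F G \<Longrightarrow> A \<in> F \<Longrightarrow> \<exists>f. embedding S f A G"
  by (auto simp: weakly_injective_def universal_def embeds_def)

text \<open>The definition speaks of inclusions of \<open>B\<close> in \<open>X\<close>; replacing
  \<open>X\<close> by a copy that contains \<open>B\<close> gives the version for arbitrary
  embeddings of \<open>B\<close>.\<close>

lemma weakly_injective_witness:
  assumes wi: "weakly_injective S F G" and A: "A \<in> F" "substructure S A G"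
  obtains B where "B \<in> F" "substructure S A B" "substructure S B G"
    "\<And>X i. X \<in> F \<Longrightarrow> embedding S i B X \<Longrightarrow> \<exists>f. embedding S f X G \<and> (\<forall>a\<in>carrier A. f (i a) = a)"
proof -
  obtain B where B: "B \<in> F" "substructure S A B" "substructure S B G"
    and ext: "\<And>X. X \<in> F \<Longrightarrow> substructure S B X \<Longrightarrow> \<exists>f. embedding S f X G \<and> (\<forall>a\<in>carrier A. f a = a)"
    using wi A unfolding weakly_injective_def by blast
  have "\<exists>f. embedding S f X G \<and> (\<forall>a\<in>carrier A. f (i a) = a)" if X: "X \<in> F" and i: "embedding S i B X" for X i
  proof -
    obtain X' j where X': "X' \<in> F" "isomorphism S j X X'" "substructure S B X'"
        "\<And>b. b \<in> carrier B \<Longrightarrow> j (i b) = b"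
      using realize_in_class[OF B(1) X i] by blast
    obtain f where f: "embedding S f X' G" "\<forall>a\<in>carrier A. f a = a" using ext[OF X'(1,3)] by blast
    have "embedding S (\<lambda>x. f (j x)) X G"
      using embedding_comp[OF isomorphismD(1)[OF X'(2)] f(1)] .
    moreover have "\<forall>a\<in>carrier A. f (j (i a)) = a"
      using f(2) X'(4) substructureD(3)[OF B(2)] by auto
    ultimately show ?thesis by blast
  qed
  then show ?thesis using that[OF B] by blast
qed

text \<open>One round of Odd. Enclose the image of \<open>g\<close> and the point \<open>u\<close>
  in some \<open>C\<close> from \<open>F\<close>, take a witness \<open>B\<close> of weak
  injectivity for \<open>C\<close>, and play a copy \<open>A'\<close> of \<open>B\<close> over
  \<open>A\<close>. The part \<open>P\<close> of \<open>A'\<close> corresponding to \<open>C\<close>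
  is where every further extension \<open>X\<close> can still be embedded with the old values;
  outside \<open>P\<close> the values of \<open>f\<close> may be lost.\<close>

lemma weakly_injective_step:
  assumes wi: "weakly_injective S F G" and A: "A \<in> F" and g: "embedding S g A G"
  obtains A' f P where "A' \<in> F" "substructure S A A'" "embedding S f A' G"
    "\<And>a. a \<in> carrier A \<Longrightarrow> f a = g a" "carrier A \<subseteq> P" "P \<subseteq> carrier A'" "u \<in> carrier G \<longrightarrow> u \<in> f ` P"
    "\<And>X. X \<in> F \<Longrightarrow> substructure S A' X \<Longrightarrow> \<exists>k. embedding S k X G \<and> (\<forall>p\<in>P. k p = f p)"
proof -
  let ?I = "image_structure S g A"
  obtain C where C: "C \<in> F" "substructure S ?I C" "substructure S C G" "u \<in> carrier G \<longrightarrow> u \<in> carrier C"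
    using sigma_absorb_point[OF weakly_injective_sigma[OF wi] class_image[OF A g]] by blast
  obtain B where B: "B \<in> F" "substructure S C B" "substructure S B G"
    and ext: "\<And>X i. X \<in> F \<Longrightarrow> embedding S i B X \<Longrightarrow> \<exists>f. embedding S f X G \<and> (\<forall>a\<in>carrier C. f (i a) = a)"
    using weakly_injective_witness[OF wi C(1,3)] by blast
  have gC: "g ` carrier A \<subseteq> carrier C" using substructureD(3)[OF C(2)] by simp
  have CB: "carrier C \<subseteq> carrier B" using substructureD(3)[OF B(2)] .
  \<comment> \<open>As a map into \<open>B\<close>, \<open>g\<close> can be realized as an
    inclusion, and \<open>f\<close> is the inverse of the resulting isomorphism.\<close>
  have "embedding S g A B" using embedding_corestrict[OF g B(3)] gC CB by blast
  then obtain A' i where A': "A' \<in> F" "isomorphism S i B A'" "substructure S A A'"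
      "\<And>a. a \<in> carrier A \<Longrightarrow> i (g a) = a"
    using realize_in_class[OF A B(1)] by blast
  note i = isomorphismD(1)[OF A'(2)]
  let ?f = "inv_into (carrier B) i"
  have fi: "?f (i b) = b" if "b \<in> carrier B" for b using embeddingD(4)[OF i] that by simp
  have f: "embedding S ?f A' G"
    using embedding_extend[OF isomorphismD(1)[OF isomorphism_inverse[OF A'(2)]] B(3)] .
  have fg: "?f a = g a" if a: "a \<in> carrier A" for a
    using fi[of "g a"] A'(4)[OF a] gC CB a by auto
  have AP: "carrier A \<subseteq> i ` carrier C"
  proof
    fix a assume "a \<in> carrier A"
    then show "a \<in> i ` carrier C" using A'(4) gC by (metis image_subset_iff rev_image_eqI)
  qed
  have PA': "i ` carrier C \<subseteq> carrier A'" using embeddingD(3)[OF i] CB by blast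
  have u: "u \<in> carrier G \<longrightarrow> u \<in> ?f ` i ` carrier C"
    using C(4) fi CB by (metis image_eqI subsetD)
  have "\<exists>k. embedding S k X G \<and> (\<forall>p\<in>i ` carrier C. k p = ?f p)" if X: "X \<in> F" "substructure S A' X" for X
    using ext[OF X(1) embedding_extend[OF i X(2)]] fi CB by (metis (no_types, lifting) imageE subsetD)
  then show ?thesis using that[OF A'(1,3) f fg AP PA' u] by blast
qed

lemma enumerate_sigma:
  assumes "G \<in> sigma_class S F"
  shows "\<exists>u :: nat \<Rightarrow> 'a. carrier G \<subseteq> range u"
proof (cases "carrier G = {}")
  case False
  then have "carrier G \<subseteq> range (from_nat_into (carrier G))"
    using range_from_nat_into[OF False sigma_countable[OF assms]] by simp
  then show ?thesis by blast
qed simp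

text \<open>Odd builds \<open>A\<^sub>\<infinity>\<close> together with an isomorphism onto \<open>G\<close>. In round \<open>n\<close> the state is
  an embedding \<open>f\<close> of his last move into \<open>G\<close> with a set \<open>P\<close> on which its values are final.\<close>

lemma weakly_injective_odd_strategy:
  assumes wi: "weakly_injective S F G" and e: "\<And>A. A \<in> F \<Longrightarrow> embedding S (e A) A G"
  obtains s where "strategy S F Odd s"
    "\<And>A. chain_in S F A \<Longrightarrow> follows Odd s A \<Longrightarrow>
       \<exists>h. isomorphism S h (chain_union S A) G \<and> (\<forall>a\<in>carrier (A 0). h a = e (A 0) a)"
proof -
  obtain u :: "nat \<Rightarrow> 'a" where u: "carrier G \<subseteq> range u"
    using enumerate_sigma[OF weakly_injective_sigma[OF wi]] by blast
  define J where "J n st A \<longleftrightarrow> n = 0 \<or> (\<exists>g. embedding S g A G \<and> (\<forall>p\<in>snd st. g p = fst st p))"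
    for n :: nat and st :: "('a \<Rightarrow> 'a) \<times> 'a set" and A
  \<comment> \<open>Round 0 has to respect the prescribed embedding \<open>e A\<close>, later rounds
    the final values on \<open>snd st\<close>. Intersecting with \<open>carrier A\<close> loses
    nothing in a play, since Eve's move contains Odd's previous one.\<close>
  define R where "R n st A A' st' \<longleftrightarrow> embedding S (fst st') A' G \<and>
      (if n = 0 then \<forall>a\<in>carrier A. fst st' a = e A a else \<forall>p\<in>snd st \<inter> carrier A. fst st' p = fst st p) \<and>
      carrier A \<subseteq> snd st' \<and> snd st' \<subseteq> carrier A' \<and> (u n \<in> carrier G \<longrightarrow> u n \<in> fst st' ` snd st')"
    for n :: nat and st :: "('a \<Rightarrow> 'a) \<times> 'a set" and A A' and st' :: "('a \<Rightarrow> 'a) \<times> 'a set"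
  obtain s where s: "strategy S F Odd s"
    and states: "\<And>A. chain_in S F A \<Longrightarrow> follows Odd s A \<Longrightarrow>
       \<exists>st. \<forall>n. R n (st n) (A (2 * n)) (A (Suc (2 * n))) (st (Suc n))"
  proof (rule odd_strategy_from_states[of J _ R])
    show "J 0 undefined A" for A by (simp add: J_def)
    fix n st A assume A: "A \<in> F" and J: "J n st A"
    obtain g where g: "embedding S g A G"
      "if n = 0 then \<forall>a\<in>carrier A. g a = e A a else \<forall>p\<in>snd st. g p = fst st p"
      using J e[OF A] by (cases "n = 0") (auto simp: J_def)
    obtain A' f P where *: "A' \<in> F" "substructure S A A'" "embedding S f A' G"
      "\<And>a. a \<in> carrier A \<Longrightarrow> f a = g a" "carrier A \<subseteq> P" "P \<subseteq> carrier A'" "u n \<in> carrier G \<longrightarrow> u n \<in> f ` P"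
      "\<And>X. X \<in> F \<Longrightarrow> substructure S A' X \<Longrightarrow> \<exists>k. embedding S k X G \<and> (\<forall>p\<in>P. k p = f p)"
      using weakly_injective_step[OF wi A g(1)] by blast
    have "R n st A A' (f, P)" using * g(2) by (auto simp: R_def split: if_splits)
    moreover have "\<forall>X\<in>F. substructure S A' X \<longrightarrow> J (Suc n) (f, P) X" using *(8) by (simp add: J_def)
    ultimately show "\<exists>A' st'. A' \<in> F \<and> substructure S A A' \<and> R n st A A' st' \<and>
        (\<forall>X\<in>F. substructure S A' X \<longrightarrow> J (Suc n) st' X)"
      using *(1,2) by blast
  qed blast
  have "\<exists>h. isomorphism S h (chain_union S A) G \<and> (\<forall>a\<in>carrier (A 0). h a = e (A 0) a)"
    if ch: "chain_in S F A" and fol: "follows Odd s A" for A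
  proof -
    obtain st where st: "\<And>n. R n (st n) (A (2 * n)) (A (Suc (2 * n))) (st (Suc n))"
      using states[OF ch fol] by blast
    define f where "f n = fst (st (Suc n))" for n
    define P where "P n = snd (st (Suc n))" for n
    have f_emb: "embedding S (f n) (A (Suc (2 * n))) G"
      and AP: "carrier (A (2 * n)) \<subseteq> P n" and PA: "P n \<subseteq> carrier (A (Suc (2 * n)))"
      and uP: "u n \<in> carrier G \<longrightarrow> u n \<in> f n ` P n" for n
      using st[of n] by (auto simp: R_def f_def P_def)
    have Pstep: "P n \<subseteq> carrier (A (2 * Suc n))" for n
      using PA[of n] substructureD(3)[OF chain_inD(2)[OF ch, of "Suc (2 * n)"]] by auto
    have fstep: "f (Suc n) p = f n p" if "p \<in> P n" for n p
      using st[of "Suc n"] that Pstep[of n] by (auto simp: R_def f_def P_def)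
    have Pmono: "P m \<subseteq> P n" if "m \<le> n" for m n
      using that Pstep AP by (intro lift_Suc_mono_le[of P m n]) blast+
    have feq: "f n p = f m p" if "m \<le> n" "p \<in> P m" for m n p
      using that
    proof (induction n rule: dec_induct)
      case (step n) then show ?case using fstep Pmono[of m n] by auto
    qed simp
    \<comment> \<open>The first stage at which \<open>a\<close> is final determines
      \<open>h a\<close>; by \<open>feq\<close> every later stage gives the same value.\<close>
    define h where "h a = f (LEAST n. a \<in> P n) a" for a
    have h_eq: "h a = f n a" if "a \<in> P n" for a n
      unfolding h_def
      using feq[of "LEAST n. a \<in> P n" n a] LeastI[of "\<lambda>n. a \<in> P n", OF that] Least_le[of "\<lambda>n. a \<in> P n", OF that]
      by simp
    have "embedding S h (A n) G" for n
    proof -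
      have "carrier (A n) \<subseteq> P n"
        using substructureD(3)[OF chain_in_mono[OF ch, of n "2 * n"]] AP[of n] by auto
      moreover have "embedding S (f n) (A n) G"
        by (rule embedding_restrict[OF f_emb chain_in_mono[OF ch]]) simp
      ultimately show ?thesis using h_eq by (auto intro: embedding_cong)
    qed
    then have emb: "embedding S h (chain_union S A) G" by (rule embedding_chain_union[OF ch])
    \<comment> \<open>Round \<open>n\<close> put the point \<open>u n\<close> into the image of the
      final set \<open>P n\<close>, hence into the range of \<open>h\<close>.\<close>
    have "carrier G \<subseteq> h ` carrier (chain_union S A)"
    proof
      fix x assume x: "x \<in> carrier G"
      then obtain n where "x = u n" using u by auto
      then obtain p where "p \<in> P n" "x = f n p" using uP x by auto
      then have "x = h p" "p \<in> carrier (chain_union S A)" using h_eq PA[of n] by auto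
      then show "x \<in> h ` carrier (chain_union S A)" by blast
    qed
    then have "isomorphism S h (chain_union S A) G"
      using emb embeddingD(3)[OF emb] by (auto simp: isomorphism_def)
    moreover have "h a = e (A 0) a" if "a \<in> carrier (A 0)" for a
      using st[of 0] that h_eq[of a 0] AP[of 0] by (auto simp: R_def f_def P_def)
    ultimately show ?thesis by blast
  qed
  then show ?thesis by (rule that[OF s])
qed

lemma weakly_injective_odd_wins:
  assumes wi: "weakly_injective S F G"
  shows "\<exists>s. BM_iso_winning S F G Odd s"
proof -
  obtain e where e: "\<And>A. A \<in> F \<Longrightarrow> embedding S (e A) A G"
    using weakly_injective_embeds[OF wi] by metis
  obtain s where "strategy S F Odd s"
    "\<And>A. chain_in S F A \<Longrightarrow> follows Odd s A \<Longrightarrow>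
       \<exists>h. isomorphism S h (chain_union S A) G \<and> (\<forall>a\<in>carrier (A 0). h a = e (A 0) a)"
    using weakly_injective_odd_strategy[OF wi e] by blast
  then have "BM_iso_winning S F G Odd s"
    by (auto simp: BM_iso_winning_def winning_strategy_def isomorphic_def)
  then show ?thesis by blast
qed

section \<open>Uniqueness and prehomogeneity\<close>

lemma odd_wins_unique:
  assumes s: "BM_iso_winning S F U Odd s" and t: "BM_iso_winning S F V Odd t"
  shows "isomorphic S U V"
proof -
  obtain Z where Z: "Z \<in> F" using nonempty by blast
  have st: "strategy S F Odd s" "strategy S F Odd t"
    using s t by (auto simp: BM_iso_winning_def winning_strategy_def)
  \<comment> \<open>A single union, unaffected by dropping the first move, is thus isomorphic to
    both \<open>U\<close> and \<open>V\<close>.\<close>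
  obtain A where A: "chain_in S F A" "follows Odd s A"
      "chain_in S F (\<lambda>n. A (Suc n))" "follows Odd t (\<lambda>n. A (Suc n))"
    using merge_odd_strategies[OF st Z] by blast
  have "isomorphic S (chain_union S A) U" "isomorphic S (chain_union S (\<lambda>n. A (Suc n))) V"
    using s t A by (auto simp: BM_iso_winning_def winning_strategy_def)
  then show ?thesis
    unfolding chain_union_shift[OF A(1)] using isomorphic_sym isomorphic_trans by blast
qed

text \<open>Play two strategies for \<open>M\<close> against each other from \<open>A\<^sub>0 = B\<close>: the first keeps the given
  embedding of \<open>B\<close>, the second starts from an embedding of \<open>A\<^sub>1\<close> that is the identity on \<open>A\<close>.
  The two resulting isomorphisms from \<open>A\<^sub>\<infinity>\<close> to \<open>M\<close> differ by the required automorphism.\<close>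

lemma weakly_injective_prehomogeneous:
  assumes wi: "weakly_injective S F M"
  shows "prehomogeneous S M"
  unfolding prehomogeneous_def
proof (intro allI impI)
  fix A0 assume A0: "substructure S A0 M \<and> finitely_generated S A0"
  \<comment> \<open>\<open>A0\<close> is only finitely generated, whereas weak injectivity applies
    to members of \<open>F\<close>.\<close>
  obtain A where A: "A \<in> F" "substructure S A0 A" "substructure S A M"
    using sigma_absorb[OF weakly_injective_sigma[OF wi], of A0 A0] A0 by blast
  obtain B where B: "B \<in> F" "substructure S A B" "substructure S B M"
    and ext: "\<And>X i. X \<in> F \<Longrightarrow> embedding S i B X \<Longrightarrow> \<exists>f. embedding S f X M \<and> (\<forall>a\<in>carrier A. f (i a) = a)"
    using weakly_injective_witness[OF wi A(1,3)] by blast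
  obtain e0 where e0: "\<And>X. X \<in> F \<Longrightarrow> embedding S (e0 X) X M"
    using weakly_injective_embeds[OF wi] by metis
  have "\<exists>h. isomorphism S h M M \<and> (\<forall>a\<in>carrier A0. h a = e a)"
    if e': "embedding S e' B M" "\<forall>a\<in>carrier A0. e' a = e a" for e e'
  proof -
    have e1: "embedding S (if X = B then e' else e0 X) X M" if "X \<in> F" for X
      using e' e0[OF that] by simp
    have "\<forall>X. \<exists>f. X \<in> F \<longrightarrow> embedding S f X M \<and> (substructure S B X \<longrightarrow> (\<forall>a\<in>carrier A. f a = a))"
      using e0 ext[of _ "\<lambda>x. x"] by (metis embedding_iff_substructure)
    then obtain e2 where e2: "\<And>X. X \<in> F \<Longrightarrow> embedding S (e2 X) X M"
        "\<And>X a. X \<in> F \<Longrightarrow> substructure S B X \<Longrightarrow> a \<in> carrier A \<Longrightarrow> e2 X a = a"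
      by metis
    obtain s1 where s1: "strategy S F Odd s1"
      "\<And>A. chain_in S F A \<Longrightarrow> follows Odd s1 A \<Longrightarrow>
         \<exists>h. isomorphism S h (chain_union S A) M \<and> (\<forall>a\<in>carrier (A 0). h a = (if A 0 = B then e' else e0 (A 0)) a)"
      using weakly_injective_odd_strategy[OF wi e1] by blast
    obtain s2 where s2: "strategy S F Odd s2"
      "\<And>A. chain_in S F A \<Longrightarrow> follows Odd s2 A \<Longrightarrow>
         \<exists>h. isomorphism S h (chain_union S A) M \<and> (\<forall>a\<in>carrier (A 0). h a = e2 (A 0) a)"
      using weakly_injective_odd_strategy[OF wi e2(1)] by blast
    obtain X where X: "chain_in S F X" "X 0 = B" "follows Odd s1 X"
        "chain_in S F (\<lambda>n. X (Suc n))" "follows Odd s2 (\<lambda>n. X (Suc n))"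
      using merge_odd_strategies[OF s1(1) s2(1) B(1)] .
    have BX: "substructure S B (X (Suc 0))" using chain_inD(2)[OF X(1), of 0] X(2) by simp
    obtain h where h: "isomorphism S h (chain_union S X) M" "\<And>a. a \<in> carrier B \<Longrightarrow> h a = e' a"
      using s1(2)[OF X(1,3)] X(2) by auto
    obtain k where k: "isomorphism S k (chain_union S X) M" "\<And>a. a \<in> carrier (X (Suc 0)) \<Longrightarrow> k a = e2 (X (Suc 0)) a"
      using s2(2)[OF X(4,5)] chain_union_shift[OF X(1)] by auto
    let ?k' = "inv_into (carrier (chain_union S X)) k"
    have "isomorphism S (\<lambda>x. h (?k' x)) M M"
      using isomorphism_comp[OF isomorphism_inverse[OF k(1)] h(1)] .
    \<comment> \<open>On \<open>A0\<close> the second isomorphism \<open>k\<close> is the identity,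
      by the choice of \<open>e2\<close>, and the first isomorphism \<open>h\<close> is
      \<open>e'\<close>.\<close>
    moreover have "h (?k' a) = e a" if a0: "a \<in> carrier A0" for a
    proof -
      have a: "a \<in> carrier A" "a \<in> carrier B" "a \<in> carrier (X (Suc 0))"
        using a0 substructureD(3)[OF A(2)] substructureD(3)[OF B(2)] substructureD(3)[OF BX] by auto
      then have "k a = a" using k(2) e2(2)[OF chain_inD(1)[OF X(1)] BX] by simp
      then have "?k' a = a"
        using inv_into_f_f[OF embeddingD(4)[OF isomorphismD(1)[OF k(1)]], of a] a(3) by auto
      then show ?thesis using h(2)[OF a(2)] e'(2) a0 by simp
    qed
    ultimately show ?thesis by blast
  qed
  then show "\<exists>B. substructure S B M \<and> finitely_generated S B \<and> substructure S A0 B \<and>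
      (\<forall>e. embedding S e A0 M \<and> (\<exists>e'. embedding S e' B M \<and> (\<forall>a\<in>carrier A0. e' a = e a)) \<longrightarrow>
           (\<exists>h. isomorphism S h M M \<and> (\<forall>a\<in>carrier A0. h a = e a)))"
    using B class_finitely_generated[OF B(1)] substructure_trans[OF A(2) B(2)] by blast
qed

text \<open>Universality embeds \<open>X\<close> by some \<open>k\<close>. Its restriction to
  \<open>A\<close> extends to \<open>B\<close>, namely by \<open>k\<close> itself, so an
  automorphism \<open>h\<close> agrees with \<open>k\<close> on \<open>A\<close>, and the inverse of
  \<open>h\<close> after \<open>k\<close> fixes \<open>A\<close>. The required member of
  \<open>F\<close> is some \<open>C\<close> enclosing \<open>B\<close>.\<close>

lemma prehomogeneous_weakly_injective:
  assumes univ: "universal S F M" and pre: "prehomogeneous S M"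
  shows "weakly_injective S F M"
  unfolding weakly_injective_def
proof (intro conjI ballI impI)
  show "universal S F M" by fact
  fix A assume A: "A \<in> F" "substructure S A M"
  obtain B where B: "substructure S B M" "finitely_generated S B" "substructure S A B"
    and hom: "\<forall>e. embedding S e A M \<and> (\<exists>e'. embedding S e' B M \<and> (\<forall>a\<in>carrier A. e' a = e a)) \<longrightarrow>
      (\<exists>h. isomorphism S h M M \<and> (\<forall>a\<in>carrier A. h a = e a))"
    using pre[unfolded prehomogeneous_def, THEN spec, of A, THEN mp, OF conjI[OF A(2) class_finitely_generated[OF A(1)]]]
    by (elim exE conjE) (rule that)
  obtain C where C: "C \<in> F" "substructure S B C" "substructure S C M"
    using sigma_absorb[OF _ B(2,1) B(2,1)] univ unfolding universal_def by blast
  have AC: "substructure S A C" using substructure_trans[OF B(3) C(2)] .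
  have "\<exists>f. embedding S f X M \<and> (\<forall>a\<in>carrier A. f a = a)" if X: "X \<in> F" "substructure S C X" for X
  proof -
    obtain k where k: "embedding S k X M" using univ X(1) by (auto simp: universal_def embeds_def)
    have kB: "embedding S k B M" using embedding_restrict[OF k substructure_trans[OF C(2) X(2)]] .
    then obtain h where h: "isomorphism S h M M" "\<forall>a\<in>carrier A. h a = k a"
      using hom embedding_restrict[OF kB B(3)] kB by blast
    let ?h' = "inv_into (carrier M) h"
    have "embedding S (\<lambda>x. ?h' (k x)) X M"
      using embedding_comp[OF k isomorphismD(1)[OF isomorphism_inverse[OF h(1)]]] .
    moreover have "?h' (k a) = a" if a: "a \<in> carrier A" for a
      using h(2) a inv_into_f_f[OF embeddingD(4)[OF isomorphismD(1)[OF h(1)]], of a]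
        substructureD(3)[OF A(2)] by auto
    ultimately show ?thesis by blast
  qed
  then show "\<exists>B\<in>F. substructure S A B \<and> substructure S B M \<and>
      (\<forall>X\<in>F. substructure S B X \<longrightarrow> (\<exists>f. embedding S f X M \<and> (\<forall>a\<in>carrier A. f a = a)))"
    using C(1,3) AC by blast
qed

lemma weakly_injective_isomorphic:
  assumes wi: "weakly_injective S F U" and M: "M \<in> sigma_class S F" and iso: "isomorphic S M U"
  shows "weakly_injective S F M"
proof -
  obtain h where h: "isomorphism S h M U" using iso by (auto simp: isomorphic_def)
  let ?h' = "inv_into (carrier M) h"
  have h': "isomorphism S ?h' U M" by (rule isomorphism_inverse[OF h])
  have hh: "?h' (h a) = a" if "a \<in> carrier M" for a
    using embeddingD(4)[OF isomorphismD(1)[OF h]] that by simp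
  have univ: "universal S F M"
    using M weakly_injective_embeds[OF wi] embedding_comp[OF _ isomorphismD(1)[OF h']]
    unfolding universal_def embeds_def by blast
  show ?thesis
    unfolding weakly_injective_def
  proof (intro conjI ballI impI univ)
    fix A assume A: "A \<in> F" "substructure S A M"
    have hA: "embedding S h A U" using embedding_restrict[OF isomorphismD(1)[OF h] A(2)] .
    note AM = substructureD(3)[OF A(2)]
    obtain B where B: "B \<in> F" "substructure S (image_structure S h A) B" "substructure S B U"
      and ext: "\<And>X i. X \<in> F \<Longrightarrow> embedding S i B X \<Longrightarrow>
        \<exists>f. embedding S f X U \<and> (\<forall>a\<in>carrier (image_structure S h A). f (i a) = a)"
      using weakly_injective_witness[OF wi class_image[OF A(1) hA]] by blast
    have h'B: "embedding S ?h' B M" using embedding_restrict[OF isomorphismD(1)[OF h'] B(3)] .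
    let ?B = "image_structure S ?h' B"
    have "carrier A \<subseteq> carrier ?B"
    proof
      fix a assume a: "a \<in> carrier A"
      then have "h a \<in> carrier B" using substructureD(3)[OF B(2)] by auto
      then show "a \<in> carrier ?B" using hh[of a] AM a by (auto intro!: image_eqI[of a ?h' "h a"])
    qed
    then have AB: "substructure S A ?B"
      using substructure_of_carrier_subset[OF A(2) class_image(2)[OF B(1) h'B]] by blast
    have "\<exists>f. embedding S f X M \<and> (\<forall>a\<in>carrier A. f a = a)" if X: "X \<in> F" "substructure S ?B X" for X
    proof -
      have "embedding S ?h' B X"
        using embedding_extend[OF isomorphismD(1)[OF isomorphism_image_of_embedding[OF h'B]] X(2)] .
      then obtain f where f: "embedding S f X U" "\<forall>a\<in>carrier A. f (?h' (h a)) = h a"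
        using ext[OF X(1)] by auto
      have "embedding S (\<lambda>x. ?h' (f x)) X M" using embedding_comp[OF f(1) isomorphismD(1)[OF h']] .
      moreover have "\<forall>a\<in>carrier A. ?h' (f a) = a"
      proof
        fix a assume a: "a \<in> carrier A"
        then have "a \<in> carrier M" using AM by auto
        then show "?h' (f a) = a" using f(2) a hh by metis
      qed
      ultimately show ?thesis by blast
    qed
    then show "\<exists>B\<in>F. substructure S A B \<and> substructure S B M \<and>
        (\<forall>X\<in>F. substructure S B X \<longrightarrow> (\<exists>f. embedding S f X M \<and> (\<forall>a\<in>carrier A. f a = a)))"
      using AB class_image[OF B(1) h'B] by blast
  qed
qed

section \<open>Weak amalgamation\<close>

definition amalgamates :: "('f, 'r, 'a) fo_structure \<Rightarrow> ('f, 'r, 'a) fo_structure \<Rightarrow> bool" where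
  "amalgamates Z Z' \<longleftrightarrow> substructure S Z Z' \<and>
     (\<forall>X\<in>F. \<forall>Y\<in>F. \<forall>f g. embedding S f Z' X \<and> embedding S g Z' Y \<longrightarrow>
        (\<exists>V\<in>F. \<exists>f' g'. embedding S f' X V \<and> embedding S g' Y V \<and> (\<forall>z\<in>carrier Z. f' (f z) = g' (g z))))"

lemma WAP_iff_amalgamates: "WAP S F \<longleftrightarrow> (\<forall>Z\<in>F. \<exists>Z'\<in>F. amalgamates Z Z')"
  by (simp add: WAP_def amalgamates_def)

text \<open>A smaller \<open>Z\<close> weakens the equation to be met, and embeddings of a larger
  \<open>Z'\<close> restrict to the old one. Each stage of a chain thus passes its amalgamation
  property on to later stages.\<close>

lemma amalgamates_mono:
  assumes am: "amalgamates Z Z'" and sub: "substructure S Y Z" "substructure S Z' Y'"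
  shows "amalgamates Y Y'"
  unfolding amalgamates_def
proof (intro conjI ballI allI impI)
  show "substructure S Y Y'"
    using am sub substructure_trans unfolding amalgamates_def by blast
  fix X1 X2 f g assume X: "X1 \<in> F" "X2 \<in> F" and fg: "embedding S f Y' X1 \<and> embedding S g Y' X2"
  have "embedding S f Z' X1 \<and> embedding S g Z' X2"
    using fg embedding_restrict[OF _ sub(2)] by blast
  then obtain V f' g' where "V \<in> F" "embedding S f' X1 V" "embedding S g' X2 V"
      "\<forall>z\<in>carrier Z. f' (f z) = g' (g z)"
    using am X unfolding amalgamates_def by meson
  then show "\<exists>V\<in>F. \<exists>f' g'. embedding S f' X1 V \<and> embedding S g' X2 V \<and> (\<forall>z\<in>carrier Y. f' (f z) = g' (g z))"
    using substructureD(3)[OF sub(1)] by blast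
qed

text \<open>\<open>P\<close> says that a task is due: to map \<open>Y\<close> into the next
  structure so that \<open>f\<close> is undone on \<open>N\<close>. Amalgamating \<open>A\<close>
  with \<open>Y\<close> over \<open>N\<close> settles it; passing afterwards to a witness of weak
  amalgamation prepares the tasks of the following stages.\<close>

lemma amalgamation_step:
  assumes wap: "WAP S F" and A: "A \<in> F"
    and task: "P \<Longrightarrow> amalgamates N N' \<and> substructure S N' A \<and> Y \<in> F \<and> embedding S f N' Y"
  shows "\<exists>V\<in>F. amalgamates A V \<and> (P \<longrightarrow> (\<exists>g. embedding S g Y V \<and> (\<forall>x\<in>carrier N. g (f x) = x)))"
proof -
  have "\<exists>V1\<in>F. substructure S A V1 \<and> (P \<longrightarrow> (\<exists>g. embedding S g Y V1 \<and> (\<forall>x\<in>carrier N. g (f x) = x)))"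
  proof (cases P)
    case True
    note t = task[OF True]
    have "embedding S (\<lambda>x. x) N' A" using t by (simp add: embedding_iff_substructure)
    then obtain V0 f' g' where V0: "V0 \<in> F" "embedding S f' A V0" "embedding S g' Y V0"
        "\<forall>z\<in>carrier N. f' z = g' (f z)"
      using t A unfolding amalgamates_def by meson
    obtain V1 i where V1: "V1 \<in> F" "isomorphism S i V0 V1" "substructure S A V1"
        "\<And>a. a \<in> carrier A \<Longrightarrow> i (f' a) = a"
      using realize_in_class[OF A V0(1,2)] by blast
    have "carrier N \<subseteq> carrier A"
      using t substructureD(3) unfolding amalgamates_def by blast
    then have "\<forall>x\<in>carrier N. i (g' (f x)) = x" using V0(4) V1(4) by (metis subsetD)
    then show ?thesis
      using V1(1,3) embedding_comp[OF V0(3) isomorphismD(1)[OF V1(2)]] by blast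
  qed (use A class_refl in blast)
  then obtain V1 where V1: "V1 \<in> F" "substructure S A V1"
      "P \<longrightarrow> (\<exists>g. embedding S g Y V1 \<and> (\<forall>x\<in>carrier N. g (f x) = x))"
    by blast
  obtain V where V: "V \<in> F" "amalgamates V1 V" using wap V1(1) by (auto simp: WAP_iff_amalgamates)
  have V1V: "substructure S V1 V" using V(2) by (simp add: amalgamates_def)
  have "amalgamates A V" using amalgamates_mono[OF V(2) V1(2) substructure_refl[OF substructureD(2)[OF V1V]]] .
  then show ?thesis using V(1) V1(3) embedding_extend[OF _ V1V] by blast
qed

section \<open>Construction of a weakly injective structure\<close>

lemma task_enumeration: "\<exists>t :: nat \<Rightarrow> nat \<times> nat \<times> nat. \<forall>a b c. \<exists>k>a. t k = (a, b, c)"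
proof -
  let ?r = "\<lambda>k. snd (prod_decode k)"
  let ?t = "\<lambda>k. (fst (prod_decode k), fst (prod_decode (?r k)), fst (prod_decode (?r (?r k))))"
  have "\<exists>k>a. ?t k = (a, b, c)" for a b c
  proof (intro exI conjI)
    \<comment> \<open>The padding \<open>Suc a\<close> forces the code above \<open>a\<close>, so a
      task about stage \<open>Suc a\<close> comes up only when that stage already exists.\<close>
    let ?k = "prod_encode (a, prod_encode (b, prod_encode (c, Suc a)))"
    have "Suc a \<le> ?k" by (meson le_prod_encode_2 order_trans)
    then show "a < ?k" by simp
    show "?t ?k = (a, b, c)" by simp
  qed
  then show ?thesis by (intro exI[of _ ?t]) blast
qed

lemma iso_type_representatives:
  assumes "countably_many_iso_types S F"
  shows "\<exists>R :: nat \<Rightarrow> ('f, 'r, 'a) fo_structure. (\<forall>i. R i \<in> F) \<and> (\<forall>X\<in>F. \<exists>i. isomorphic S X (R i))"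
proof -
  let ?E = "{(A, B). A \<in> F \<and> B \<in> F \<and> isomorphic S A B}"
  define c where "c i = from_nat_into (F // ?E) i" for i
  have ne: "F // ?E \<noteq> {}" using nonempty by (auto simp: quotient_def)
  have refl: "isomorphic S X X" if "X \<in> F" for X
    using class_refl[OF that] by (auto simp: isomorphic_def isomorphism_def embedding_iff_substructure intro!: exI[of _ "\<lambda>x. x"])
  define R where "R i = (SOME X. X \<in> c i)" for i
  have R: "R i \<in> c i" for i
  proof -
    have "c i \<in> F // ?E" unfolding c_def using from_nat_into[OF ne] .
    then obtain X where "X \<in> F" "c i = ?E `` {X}" by (auto simp: quotient_def)
    then have "X \<in> c i" using refl by auto
    then show ?thesis unfolding R_def by (rule someI)
  qed
  have cF: "c i \<subseteq> F" for i
    using from_nat_into[OF ne, of i] by (auto simp: c_def quotient_def)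
  have "\<exists>i. isomorphic S X (R i)" if X: "X \<in> F" for X
  proof -
    have "?E `` {X} \<in> F // ?E" using X by (rule quotientI)
    then obtain i where "c i = ?E `` {X}"
      using from_nat_into_surj[OF assms[unfolded countably_many_iso_types_def]] unfolding c_def by blast
    then show ?thesis using R[of i] by auto
  qed
  then show ?thesis using R cF by blast
qed

text \<open>A task \<open>(n, i, j)\<close> names a stage, a representative \<open>R i\<close> of an
  isomorphism type, and the \<open>j\<close>-th entry in the list of embeddings of
  \<open>A (Suc n)\<close> into \<open>R i\<close>. Since \<open>A (Suc n)\<close> is a witness of
  weak amalgamation for \<open>A n\<close>, the task can be solved at any later stage.\<close>

lemma weak_Fraisse_sequence:
  assumes wap: "WAP S F" and types: "countably_many_iso_types S F"
  obtains A where "chain_in S F A"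
    "\<And>n f Y. Y \<in> F \<Longrightarrow> embedding S f (A (Suc n)) Y \<Longrightarrow>
       \<exists>k g. embedding S g Y (A k) \<and> (\<forall>x\<in>carrier (A n). g (f x) = x)"
proof -
  obtain R :: "nat \<Rightarrow> ('f, 'r, 'a) fo_structure" where
    R: "\<And>i. R i \<in> F" "\<And>X. X \<in> F \<Longrightarrow> \<exists>i. isomorphic S X (R i)"
    using iso_type_representatives[OF types] by blast
  obtain t :: "nat \<Rightarrow> nat \<times> nat \<times> nat" where t: "\<forall>a b c. \<exists>k>a. t k = (a, b, c)"
    using task_enumeration by blast
  define n i j where "n k = fst (t k)" and "i k = fst (snd (t k))" and "j k = snd (snd (t k))" for k
  have nij: "\<exists>k>a. n k = a \<and> i k = b \<and> j k = c" for a b c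
    using t[rule_format, of a b c] by (auto simp: n_def i_def j_def)
  have "\<forall>X Y. \<exists>E :: nat \<Rightarrow> 'a \<Rightarrow> 'a. X \<in> F \<and> Y \<in> F \<longrightarrow>
      (\<forall>h. embedding S h X Y \<longrightarrow> (\<exists>n. \<forall>a\<in>carrier X. h a = E n a))"
    using countable_embeddings[OF class_finitely_generated class_countable] by metis
  then obtain E :: "('f, 'r, 'a) fo_structure \<Rightarrow> ('f, 'r, 'a) fo_structure \<Rightarrow> nat \<Rightarrow> 'a \<Rightarrow> 'a" where
    E: "\<And>X Y h. X \<in> F \<Longrightarrow> Y \<in> F \<Longrightarrow> embedding S h X Y \<Longrightarrow> \<exists>n. \<forall>a\<in>carrier X. h a = E X Y n a"
    by metis
  \<comment> \<open>A task is void if its stage is not yet available or if the listed function is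
    not an embedding.\<close>
  define active where "active X k \<longleftrightarrow> n k < k \<and> embedding S (E (X (Suc (n k))) (R (i k)) (j k)) (X (Suc (n k))) (R (i k))" for X k
  define solved where "solved X k V \<longleftrightarrow> (\<exists>g. embedding S g (R (i k)) V \<and>
      (\<forall>x\<in>carrier (X (n k)). g (E (X (Suc (n k))) (R (i k)) (j k) x) = x))" for X k V
  define good where "good X k V \<longleftrightarrow> V \<in> F \<and> amalgamates (X k) V \<and> (active X k \<longrightarrow> solved X k V)" for X k V
  obtain Z where Z: "Z \<in> F" using nonempty by blast
  obtain A where A: "\<And>m. A m = (\<lambda>p. if p = [] then Z else SOME V. good (nth p) (length p - 1) V) (map A [0..<m])"
    using play_exists[of "\<lambda>p. if p = [] then Z else SOME V. good (nth p) (length p - 1) V"] by blast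
  have A0: "A 0 = Z" by (subst A) simp
  have A_Suc: "A (Suc k) = (SOME V. good A k V)" for k
  proof -
    \<comment> \<open>\<open>good\<close> at \<open>k\<close> inspects only entries up to index
      \<open>k\<close>, which the history of length \<open>Suc k\<close> contains.\<close>
    have "good (nth (map A [0..<Suc k])) k = good A k"
    proof -
      have eq: "map A [0..<Suc k] ! m = A m" if "m \<le> k" for m using that by (simp add: nth_append del: upt_Suc)
      have "active (nth (map A [0..<Suc k])) k = active A k"
        using eq by (auto simp: active_def simp del: upt_Suc)
      moreover have "solved (nth (map A [0..<Suc k])) k V = solved A k V" if "n k < k" for V
        using eq[of "n k"] eq[of "Suc (n k)"] that by (simp add: solved_def del: upt_Suc)
      ultimately show ?thesis
        using eq[of k] unfolding good_def active_def by (intro ext) auto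
    qed
    then show ?thesis by (subst A) (simp del: upt_Suc)
  qed
  have inv: "A k \<in> F \<and> (\<forall>m<k. amalgamates (A m) (A k)) \<and> (k \<noteq> 0 \<longrightarrow> good A (k - 1) (A k))" for k
  proof (induction k rule: less_induct)
    case (less k)
    show ?case
    proof (cases k)
      case 0
      then show ?thesis using A0 Z by simp
    next
      case (Suc l)
      have IH: "A m \<in> F" "\<And>m'. m' < m \<Longrightarrow> amalgamates (A m') (A m)" if "m \<le> l" for m
        using less.IH[of m] that Suc by auto
      have sub: "substructure S (A m') (A m)" if "m' \<le> m" "m \<le> l" for m m'
        using IH[OF that(2)] that class_refl by (cases "m' = m") (auto simp: amalgamates_def)
      have "\<exists>V. good A l V"
        using amalgamation_step[OF wap IH(1)[of l], of "active A l" "A (n l)" "A (Suc (n l))" "R (i l)"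
            "E (A (Suc (n l))) (R (i l)) (j l)"]
          IH(2)[of "Suc (n l)" "n l"] sub[of "Suc (n l)" l] R(1)
        by (auto simp: good_def solved_def active_def)
      then have good: "good A l (A k)" unfolding Suc A_Suc by (rule someI_ex)
      then have "amalgamates (A l) (A k)" by (simp add: good_def)
      moreover have "substructure S (A l) (A k)" using calculation by (simp add: amalgamates_def)
      moreover have "amalgamates (A m) (A k)" if "m < l" for m
        using amalgamates_mono[OF IH(2)[OF order_refl that] _ calculation(2)] sub[of m m] that by auto
      ultimately show ?thesis using good Suc by (auto simp: good_def less_Suc_eq)
    qed
  qed
  have ch: "chain_in S F A"
    unfolding chain_in_def using inv by (metis amalgamates_def lessI)
  have "\<exists>k g. embedding S g Y (A k) \<and> (\<forall>x\<in>carrier (A m). g (f x) = x)"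
    if Y: "Y \<in> F" and f: "embedding S f (A (Suc m)) Y" for m f Y
  proof -
    \<comment> \<open>Only representatives and listed embeddings were treated: \<open>Y\<close> is
      moved to \<open>R b\<close>, and the listed function agrees with the moved embedding on
      \<open>A (Suc m)\<close>, hence on \<open>A m\<close>.\<close>
    obtain b h where h: "isomorphism S h Y (R b)" using R(2)[OF Y] by (auto simp: isomorphic_def)
    have hf: "embedding S (\<lambda>x. h (f x)) (A (Suc m)) (R b)" using embedding_comp[OF f isomorphismD(1)[OF h]] .
    obtain c where c: "\<And>a. a \<in> carrier (A (Suc m)) \<Longrightarrow> h (f a) = E (A (Suc m)) (R b) c a"
      using E[OF chain_inD(1)[OF ch] R(1) hf] by blast
    obtain k where k: "m < k" "n k = m" "i k = b" "j k = c" using nij by blast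
    have "embedding S (E (A (Suc m)) (R b) c) (A (Suc m)) (R b)"
      by (rule embedding_cong[OF hf]) (simp add: c)
    then have "active A k" using k by (simp add: active_def)
    then have "solved A k (A (Suc k))" using inv[of "Suc k"] by (simp add: good_def)
    then obtain g where g: "embedding S g (R b) (A (Suc k))" "\<forall>x\<in>carrier (A m). g (E (A (Suc m)) (R b) c x) = x"
      using k by (auto simp: solved_def)
    have "\<forall>x\<in>carrier (A m). g (h (f x)) = x"
      using g(2) c substructureD(3)[OF chain_inD(2)[OF ch]] by (metis subsetD)
    then show ?thesis using embedding_comp[OF isomorphismD(1)[OF h] g(1)] by blast
  qed
  then show ?thesis using that ch by blast
qed

text \<open>For universality, joint embedding puts \<open>X\<close> and \<open>A (Suc 0)\<close>
  into one \<open>Y\<close>, which the sequence maps back into itself. For weak injectivity, the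
  witness for a substructure of \<open>A m\<close> is \<open>A (Suc m)\<close>.\<close>

lemma weakly_injective_exists:
  assumes "WAP S F" "JEP S F" "countably_many_iso_types S F"
  obtains U where "weakly_injective S F U"
proof -
  obtain A where ch: "chain_in S F A" and seq:
    "\<And>n f Y. Y \<in> F \<Longrightarrow> embedding S f (A (Suc n)) Y \<Longrightarrow>
       \<exists>k g. embedding S g Y (A k) \<and> (\<forall>x\<in>carrier (A n). g (f x) = x)"
    using weak_Fraisse_sequence[OF assms(1,3)] by metis
  let ?U = "chain_union S A"
  note AU = substructure_chain_union[OF ch]
  have univ: "universal S F ?U"
    unfolding universal_def
  proof (intro conjI ballI)
    show "?U \<in> sigma_class S F" using ch by (auto simp: sigma_class_def)
    fix X assume X: "X \<in> F"
    obtain Y h f where Y: "Y \<in> F" "embedding S h X Y" "embedding S f (A (Suc 0)) Y"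
      using assms(2) X chain_inD(1)[OF ch] unfolding JEP_def embeds_def by meson
    obtain k g where "embedding S g Y (A k)" using seq[OF Y(1,3)] by blast
    then show "embeds S X ?U"
      using embedding_comp[OF Y(2)] embedding_extend[OF _ AU] unfolding embeds_def by blast
  qed
  have "weakly_injective S F ?U"
    unfolding weakly_injective_def
  proof (intro conjI ballI impI univ)
    fix C assume C: "C \<in> F" "substructure S C ?U"
    obtain m where m: "substructure S C (A m)"
      using finitely_generated_substructure_chain_union[OF ch class_finitely_generated[OF C(1)] C(2)] .
    have "\<exists>f. embedding S f X ?U \<and> (\<forall>a\<in>carrier C. f a = a)"
      if X: "X \<in> F" "substructure S (A (Suc m)) X" for X
    proof -
      obtain k g where "embedding S g X (A k)" "\<forall>x\<in>carrier (A m). g x = x"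
        using seq[OF X(1) X(2)[folded embedding_iff_substructure]] by blast
      then show ?thesis using embedding_extend[OF _ AU] substructureD(3)[OF m] by blast
    qed
    then show "\<exists>B\<in>F. substructure S C B \<and> substructure S B ?U \<and>
        (\<forall>X\<in>F. substructure S B X \<longrightarrow> (\<exists>f. embedding S f X ?U \<and> (\<forall>a\<in>carrier C. f a = a)))"
      using chain_inD(1)[OF ch] AU substructure_trans[OF m chain_inD(2)[OF ch]] by blast
  qed
  then show ?thesis using that by blast
qed

section \<open>Failure of weak amalgamation\<close>

text \<open>\<open>ext True A\<close> and \<open>ext False A\<close> are incompatible over
  \<open>Z\<close> inside every member of \<open>sigma_class S F\<close>, not just of
  \<open>F\<close>, because the embeddings compared in the games have such structures as
  targets.\<close>

definition splitting ::
  "('f, 'r, 'a) fo_structure \<Rightarrow> (bool \<Rightarrow> ('f, 'r, 'a) fo_structure \<Rightarrow> ('f, 'r, 'a) fo_structure) \<Rightarrow> bool" where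
  "splitting Z ext \<longleftrightarrow> Z \<in> F \<and>
     (\<forall>A\<in>F. substructure S Z A \<longrightarrow>
        (\<forall>b. ext b A \<in> F \<and> substructure S A (ext b A)) \<and>
        (\<forall>W h k. W \<in> sigma_class S F \<and> embedding S h (ext True A) W \<and> embedding S k (ext False A) W \<longrightarrow>
           (\<exists>z\<in>carrier Z. h z \<noteq> k z)))"

lemma splittingD:
  assumes "splitting Z ext"
  shows "Z \<in> F"
    and "\<And>b A. A \<in> F \<Longrightarrow> substructure S Z A \<Longrightarrow> ext b A \<in> F"
    and "\<And>b A. A \<in> F \<Longrightarrow> substructure S Z A \<Longrightarrow> substructure S A (ext b A)"
    and "\<And>A W h k. \<lbrakk>A \<in> F; substructure S Z A; W \<in> sigma_class S F; embedding S h (ext True A) W;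
       embedding S k (ext False A) W; \<forall>z\<in>carrier Z. h z = k z\<rbrakk> \<Longrightarrow> False"
  using assms unfolding splitting_def by metis+

text \<open>If both extensions embedded into \<open>W\<close> by maps agreeing on \<open>Z\<close>,
  their finitely generated images would lie in one member of \<open>F\<close>, and this would be a
  forbidden amalgam.\<close>

lemma not_WAP_splitting:
  assumes "\<not> WAP S F"
  shows "\<exists>Z ext. splitting Z ext"
proof -
  obtain Z where Z: "Z \<in> F" "\<And>A. A \<in> F \<Longrightarrow> \<not> amalgamates Z A"
    using assms by (auto simp: WAP_iff_amalgamates)
  have "\<exists>X'\<in>F. \<exists>Y'\<in>F. substructure S A X' \<and> substructure S A Y' \<and>
      (\<forall>W h k. W \<in> sigma_class S F \<longrightarrow> embedding S h X' W \<longrightarrow> embedding S k Y' W \<longrightarrow>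
         (\<exists>z\<in>carrier Z. h z \<noteq> k z))"
    if A: "A \<in> F" "substructure S Z A" for A
  proof -
    obtain X Y f g where X: "X \<in> F" "Y \<in> F" "embedding S f A X" "embedding S g A Y"
      and no: "\<And>V f' g'. V \<in> F \<Longrightarrow> embedding S f' X V \<Longrightarrow> embedding S g' Y V \<Longrightarrow>
         \<exists>z\<in>carrier Z. f' (f z) \<noteq> g' (g z)"
      using Z(2)[OF A(1)] A(2) unfolding amalgamates_def by blast
    obtain X' i where X': "X' \<in> F" "isomorphism S i X X'" "substructure S A X'"
        "\<And>a. a \<in> carrier A \<Longrightarrow> i (f a) = a"
      using realize_in_class[OF A(1) X(1,3)] by blast
    obtain Y' j where Y': "Y' \<in> F" "isomorphism S j Y Y'" "substructure S A Y'"
        "\<And>a. a \<in> carrier A \<Longrightarrow> j (g a) = a"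
      using realize_in_class[OF A(1) X(2,4)] by blast
    have "\<exists>z\<in>carrier Z. h z \<noteq> k z"
      if W: "W \<in> sigma_class S F" and h: "embedding S h X' W" and k: "embedding S k Y' W" for W h k
    proof -
      note hX = class_image[OF X'(1) h] and kY = class_image[OF Y'(1) k]
      obtain C where C: "C \<in> F" "substructure S (image_structure S h X') C"
          "substructure S (image_structure S k Y') C"
        using sigma_absorb[OF W class_finitely_generated[OF hX(1)] hX(2) class_finitely_generated[OF kY(1)] kY(2)] by blast
      have "embedding S h X' C" "embedding S k Y' C"
        using embedding_extend[OF isomorphismD(1)[OF isomorphism_image_of_embedding[OF h]] C(2)]
          embedding_extend[OF isomorphismD(1)[OF isomorphism_image_of_embedding[OF k]] C(3)] .
      then have "embedding S (\<lambda>x. h (i x)) X C" "embedding S (\<lambda>x. k (j x)) Y C"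
        using embedding_comp isomorphismD(1)[OF X'(2)] isomorphismD(1)[OF Y'(2)] by blast+
      then obtain z where "z \<in> carrier Z" "h (i (f z)) \<noteq> k (j (g z))" using no[OF C(1)] by blast
      then show ?thesis using X'(4) Y'(4) substructureD(3)[OF A(2)] by (metis subsetD)
    qed
    then show ?thesis using X'(1,3) Y'(1,3) by blast
  qed
  then obtain X' Y' where XY: "\<And>A. A \<in> F \<Longrightarrow> substructure S Z A \<Longrightarrow> X' A \<in> F \<and> Y' A \<in> F \<and>
      substructure S A (X' A) \<and> substructure S A (Y' A) \<and>
      (\<forall>W h k. W \<in> sigma_class S F \<longrightarrow> embedding S h (X' A) W \<longrightarrow> embedding S k (Y' A) W \<longrightarrow>
         (\<exists>z\<in>carrier Z. h z \<noteq> k z))"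
    by metis
  have "splitting Z (\<lambda>b A. if b then X' A else Y' A)"
    unfolding splitting_def
  proof (intro conjI ballI impI allI)
    fix A W h k
    assume A: "A \<in> F" "substructure S Z A" and W: "W \<in> sigma_class S F \<and>
      embedding S h (if True then X' A else Y' A) W \<and> embedding S k (if False then X' A else Y' A) W"
    then have "embedding S h (X' A) W" "embedding S k (Y' A) W" by simp_all
    then show "\<exists>z\<in>carrier Z. h z \<noteq> k z" using XY[OF A] W by blast
  qed (use Z XY in auto)
  then show ?thesis by blast
qed

section \<open>Eve against a single structure\<close>

lemma not_WAP_eve_wins:
  assumes "\<not> WAP S F" and W: "W \<in> sigma_class S F"
  shows "\<exists>s. BM_emb_winning S F {W} Eve s"
proof -
  obtain Z ext where split_ext: "splitting Z ext" using not_WAP_splitting[OF assms(1)] by blast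
  note Z = splittingD(1)[OF split_ext] and ext = splittingD(2-)[OF split_ext]
  obtain E :: "nat \<Rightarrow> 'a \<Rightarrow> 'a" where
    E: "\<And>h. embedding S h Z W \<Longrightarrow> \<exists>n. \<forall>a\<in>carrier Z. h a = E n a"
    using countable_embeddings[OF class_finitely_generated[OF Z] sigma_countable[OF W]] by blast
  have "\<forall>n A. \<exists>X. A \<in> F \<and> substructure S Z A \<longrightarrow> X \<in> F \<and> substructure S A X \<and>
      \<not> (\<exists>h. embedding S h X W \<and> (\<forall>a\<in>carrier Z. h a = E n a))"
  proof (intro allI)
    fix n :: nat and A
    show "\<exists>X. A \<in> F \<and> substructure S Z A \<longrightarrow> X \<in> F \<and> substructure S A X \<and>
      \<not> (\<exists>h. embedding S h X W \<and> (\<forall>a\<in>carrier Z. h a = E n a))"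
    \<comment> \<open>At most one of the two extensions admits an embedding that restricts to
      \<open>E n\<close>; the move \<open>kill n A\<close> is the other one.\<close>
    proof (cases "\<exists>h. embedding S h (ext True A) W \<and> (\<forall>a\<in>carrier Z. h a = E n a)")
      case True
      then show ?thesis
        using ext(1)[of A False] ext(2)[of A False] ext(3)[OF _ _ W] by (intro exI[of _ "ext False A"]) force
    next
      case False
      then show ?thesis
        using ext(1)[of A True] ext(2)[of A True] by (intro exI[of _ "ext True A"]) blast
    qed
  qed
  then obtain kill where kill: "\<And>n A. A \<in> F \<Longrightarrow> substructure S Z A \<Longrightarrow>
      kill n A \<in> F \<and> substructure S A (kill n A) \<and>
      \<not> (\<exists>h. embedding S h (kill n A) W \<and> (\<forall>a\<in>carrier Z. h a = E n a))"
    by metis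
  \<comment> \<open>After the opening, Eve moves at positions of length \<open>2 * n + 2\<close>, so
    the index is \<open>n\<close> and the move excludes \<open>E n\<close>.\<close>
  define c where "c p = (if p = [] then Z else kill (length p div 2 - 1) (last p))" for p
  have "\<not> embeds S (chain_union S A) W" if ch: "chain_in S F A" and fol: "follows Eve (make_legal c) A" for A
  proof
    assume "embeds S (chain_union S A) W"
    then obtain h where h: "embedding S h (chain_union S A) W" by (auto simp: embeds_def)
    have A: "A m = make_legal c (map A [0..<m])" if "even m" for m
      using fol that by (auto simp: follows_def)
    have "A 0 = Z" using A[of 0] make_legal_eq[of "[]" c] Z by (simp add: c_def)
    then have ZA: "substructure S Z (A m)" for m using chain_in_mono[OF ch, of 0 m] by simp
    have hA: "embedding S h (A m) W" for m using embedding_restrict[OF h substructure_chain_union[OF ch]] .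
    obtain n where n: "\<forall>a\<in>carrier Z. h a = E n a"
      using E[OF embedding_restrict[OF hA ZA]] by blast
    let ?p = "map A [0..<Suc (Suc (2 * n))]"
    have c: "c ?p = kill n (A (Suc (2 * n)))" by (simp add: c_def)
    have "A (Suc (Suc (2 * n))) = make_legal c ?p" by (rule A) simp
    also have "\<dots> = c ?p"
    proof (rule make_legal_eq)
      show "position S F ?p" using ch by (simp add: chain_in_iff_positions del: upt_Suc)
      show "c ?p \<in> F" "substructure S (last ?p) (c ?p)"
        unfolding c using kill[OF chain_inD(1)[OF ch] ZA] by auto
    qed
    finally have "A (Suc (Suc (2 * n))) = kill n (A (Suc (2 * n)))" using c by simp
    then show False using kill[OF chain_inD(1)[OF ch] ZA, of n "Suc (2 * n)"] hA[of "Suc (Suc (2 * n))"] n by auto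
  qed
  then have "BM_emb_winning S F {W} Eve (make_legal c)"
    using strategy_make_legal by (auto simp: BM_emb_winning_def winning_strategy_def)
  then show ?thesis by blast
qed

text \<open>An isomorphism is an embedding, so Odd's target in the second game is contained in his
  target in the first.\<close>

lemma eve_wins_iso_of_emb:
  assumes "BM_emb_winning S F {W} Eve s"
  shows "BM_iso_winning S F W Eve s"
  using assms unfolding BM_emb_winning_def BM_iso_winning_def winning_strategy_def
  by (auto simp: isomorphic_def isomorphism_def embeds_def)

text \<open>Eve's moves along a branch \<open>x\<close> of the binary tree; the results of two different branches
  cannot embed into the same structure by maps that agree on \<open>Z\<close>.\<close>

lemma odd_emb_wins_imp_lepoll:
  assumes "\<not> WAP S F" and \<U>: "\<U> \<subseteq> sigma_class S F" and win: "BM_emb_winning S F \<U> Odd s"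
  shows "(UNIV :: (nat \<Rightarrow> bool) set) \<lesssim> \<U> \<times> (UNIV :: nat set)"
proof -
  obtain Z ext where split_ext: "splitting Z ext" using not_WAP_splitting[OF assms(1)] by blast
  note Z = splittingD(1)[OF split_ext] and ext = splittingD(2-)[OF split_ext]
  have s: "strategy S F Odd s"
    and win': "\<And>A. chain_in S F A \<Longrightarrow> follows Odd s A \<Longrightarrow> \<exists>U\<in>\<U>. embeds S (chain_union S A) U"
    using win by (auto simp: BM_emb_winning_def winning_strategy_def)
  define c where "c x p = (if p = [] then Z else ext (x (length p div 2 - 1)) (last p))" for x :: "nat \<Rightarrow> bool" and p
  have "\<forall>x. \<exists>A. chain_in S F A \<and> follows Eve (make_legal (c x)) A \<and> follows Odd s A"
    using play_of_strategies[OF strategy_make_legal s] by metis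
  then obtain A where ch: "\<And>x. chain_in S F (A x)"
    and eve: "\<And>x. follows Eve (make_legal (c x)) (A x)" and odd: "\<And>x. follows Odd s (A x)"
    by metis
  have even_move: "A x m = make_legal (c x) (map (A x) [0..<m])" if "even m" for x m
    using eve[of x] that by (auto simp: follows_def)
  have odd_move: "A x m = s (map (A x) [0..<m])" if "odd m" for x m
    using odd[of x] that by (auto simp: follows_def)
  have A0: "A x 0 = Z" for x using even_move[of 0 x] make_legal_eq[of "[]" "c x"] Z by (simp add: c_def)
  then have ZA: "substructure S Z (A x m)" for x m using chain_in_mono[OF ch, of 0 m x] by simp
  have split: "A x (Suc (Suc (2 * n))) = ext (x n) (A x (Suc (2 * n)))" for x n
  proof -
    let ?p = "map (A x) [0..<Suc (Suc (2 * n))]"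
    have c: "c x ?p = ext (x n) (A x (Suc (2 * n)))" by (simp add: c_def)
    have "make_legal (c x) ?p = c x ?p"
    proof (rule make_legal_eq)
      show "position S F ?p" using ch by (simp add: chain_in_iff_positions del: upt_Suc)
      show "c x ?p \<in> F" "substructure S (last ?p) (c x ?p)"
        unfolding c using ext(1,2)[OF chain_inD(1)[OF ch] ZA] by auto
    qed
    then show ?thesis using c even_move[of "Suc (Suc (2 * n))" x] by simp
  qed
  \<comment> \<open>The bit \<open>x n\<close> is first consulted for the move number
    \<open>2 * n + 2\<close>; branches that agree below \<open>n\<close> share all earlier
    moves.\<close>
  have agree: "A x m = A y m" if "\<And>l. l < n \<Longrightarrow> x l = y l" "m < Suc (Suc (2 * n))" for x y n m
    using that(2)
  proof (induction m rule: less_induct)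
    case (less m)
    then have eq: "map (A x) [0..<m] = map (A y) [0..<m]" by simp
    show ?case
    proof (cases "even m")
      case True
      show ?thesis
      proof (cases "m = 0")
        case False
        then have "m div 2 - 1 < n" using less.prems True by (auto elim!: evenE)
        then have "c x (map (A y) [0..<m]) = c y (map (A y) [0..<m])" using that(1) by (simp add: c_def)
        then have "make_legal (c x) (map (A y) [0..<m]) = make_legal (c y) (map (A y) [0..<m])"
          by (simp add: make_legal_def)
        then show ?thesis unfolding even_move[OF True] eq .
      qed (simp add: A0)
    next
      case False
      then show ?thesis by (simp only: odd_move[OF False] eq)
    qed
  qed
  obtain U h where U: "\<And>x. U x \<in> \<U>" and h: "\<And>x. embedding S (h x) (chain_union S (A x)) (U x)"
    using win'[OF ch odd] unfolding embeds_def by metis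
  have hA: "embedding S (h x) (A x m) (U x)" for x m
    using embedding_restrict[OF h substructure_chain_union[OF ch]] .
  have "\<forall>V. \<exists>E :: nat \<Rightarrow> 'a \<Rightarrow> 'a. V \<in> \<U> \<longrightarrow> (\<forall>h. embedding S h Z V \<longrightarrow> (\<exists>n. \<forall>a\<in>carrier Z. h a = E n a))"
    using countable_embeddings[OF class_finitely_generated[OF Z] sigma_countable] \<U> by (metis subsetD)
  then obtain E :: "('f, 'r, 'a) fo_structure \<Rightarrow> nat \<Rightarrow> 'a \<Rightarrow> 'a" where
    E: "\<And>V h. V \<in> \<U> \<Longrightarrow> embedding S h Z V \<Longrightarrow> \<exists>n. \<forall>a\<in>carrier Z. h a = E V n a"
    by metis
  have "\<forall>x. \<exists>n. \<forall>a\<in>carrier Z. h x a = E (U x) n a"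
    using E[OF U embedding_restrict[OF hA ZA]] by blast
  \<comment> \<open>\<open>N x\<close> indexes the restriction to \<open>Z\<close> of the embedding
    of branch \<open>x\<close>, in the list belonging to its target \<open>U x\<close>.\<close>
  then obtain N where N: "\<And>x a. a \<in> carrier Z \<Longrightarrow> h x a = E (U x) (N x) a" by metis
  have no: False if xy: "U x = U y" "N x = N y" "\<And>l. l < n \<Longrightarrow> x l = y l" "x n" "\<not> y n" for x y n
  proof -
    let ?Z = "A x (Suc (2 * n))"
    have "?Z = A y (Suc (2 * n))" by (rule agree[OF xy(3)]) auto
    then have "embedding S (h x) (ext True ?Z) (U x)" "embedding S (h y) (ext False ?Z) (U x)"
      using hA[of x "Suc (Suc (2 * n))"] hA[of y "Suc (Suc (2 * n))"] xy by (simp_all add: split)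
    moreover have "\<forall>z\<in>carrier Z. h x z = h y z" using N xy(1,2) by simp
    ultimately show False using ext(3)[OF chain_inD(1)[OF ch] ZA] U \<U> by blast
  qed
  have "inj (\<lambda>x. (U x, N x))"
  proof (rule injI, rule ccontr)
    fix x y assume eq: "(U x, N x) = (U y, N y)" and "x \<noteq> y"
    \<comment> \<open>At the first differing bit both branches extend the same structure in the two
      incompatible ways; \<open>no\<close> is applied in both orders, as either branch may carry
      \<open>True\<close>.\<close>
    then obtain n where "x n \<noteq> y n" "\<And>l. l < n \<Longrightarrow> x l = y l"
      using exists_least_iff[of "\<lambda>n. x n \<noteq> y n"] by blast
    then show False using no[of x y n] no[of y x n] eq by auto
  qed
  then show ?thesis unfolding lepoll_def using U by (intro exI[of _ "\<lambda>x. (U x, N x)"]) auto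
qed

end

text \<open>Reals inject into sets of naturals through their rational cuts. For infinite
  \<open>A\<close> the factor \<open>nat\<close> is absorbed, so the reals would inject into
  \<open>A\<close>; for finite \<open>A\<close> the product is countable, contradicting Cantor's
  diagonal argument.\<close>

lemma not_lepoll_Times_nat:
  assumes "A \<prec> (UNIV :: real set)"
  shows "\<not> (UNIV :: (nat \<Rightarrow> bool) set) \<lesssim> A \<times> (UNIV :: nat set)"
proof
  assume le: "(UNIV :: (nat \<Rightarrow> bool) set) \<lesssim> A \<times> (UNIV :: nat set)"
  have False if "r < t" and eq: "(\<lambda>n. of_rat (from_nat n) < r) = (\<lambda>n. of_rat (from_nat n) < t)" for r t :: real
  proof -
    obtain q where q: "r < of_rat q" "of_rat q < t" using of_rat_dense[OF \<open>r < t\<close>] by blast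
    then show False using fun_cong[OF eq, of "to_nat q"] by simp
  qed
  then have "inj (\<lambda>r n. of_rat (from_nat n) < (r :: real))"
    by (intro injI) (metis linorder_neqE)
  then have real_le: "(UNIV :: real set) \<lesssim> (UNIV :: (nat \<Rightarrow> bool) set)"
    unfolding lepoll_def by blast
  show False
  proof (cases "finite A")
    case True
    then have "countable (A \<times> (UNIV :: nat set))" by (simp add: countable_finite)
    then have "countable (UNIV :: (nat \<Rightarrow> bool) set)" using le countable_lepoll by blast
    then obtain f :: "nat \<Rightarrow> nat \<Rightarrow> bool" where "range f = UNIV"
      by (metis UNIV_not_empty range_from_nat_into)
    then obtain n where "f n = (\<lambda>m. \<not> f m m)" by (metis rangeE UNIV_I)
    then show False by (metis (full_types))
  next
    case False
    have "A \<times> (UNIV :: nat set) \<approx> A"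
      unfolding eqpoll_iff_card_of_ordIso
      using card_of_Times_infinite[OF False UNIV_not_empty] infinite_iff_card_of_nat[of A] False by blast
    then have "(UNIV :: real set) \<lesssim> A" using real_le le by (meson eqpoll_imp_lepoll lepoll_trans)
    then show False using assms by (meson lesspoll_def lepoll_antisym)
  qed
qed

theorem corollary7p1:
  fixes S :: "('f, 'r) signature"
    and F :: "('f, 'r, 'a) fo_structure set"
  assumes "uncountable (UNIV :: 'a set)"
    and "countable_signature S"
    and "fg_class S F"
    and "F \<noteq> {}"
    and "JEP S F"
    and "countably_many_iso_types S F"
  shows
    "((\<exists>\<U>. \<U> \<subseteq> sigma_class S F \<and> \<U> \<prec> (UNIV :: real set) \<and>
            (\<exists>s. BM_emb_winning S F \<U> Odd s)) \<longrightarrow>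
        WAP S F \<and>
        (\<exists>U\<in>sigma_class S F.
           (\<exists>s. BM_iso_winning S F U Odd s) \<and>
           (\<forall>V\<in>sigma_class S F. (\<exists>s. BM_iso_winning S F V Odd s) \<longrightarrow> isomorphic S V U) \<and>
           (\<forall>M\<in>sigma_class S F.
              (isomorphic S M U \<longleftrightarrow> weakly_injective S F M) \<and>
              (isomorphic S M U \<longleftrightarrow> universal S F M \<and> prehomogeneous S M)))) \<and>
     (\<not> WAP S F \<longrightarrow>
        (\<forall>W\<in>sigma_class S F.
           (\<exists>s. BM_emb_winning S F {W} Eve s) \<and>
           (\<forall>s. BM_emb_winning S F {W} Eve s \<longrightarrow> BM_iso_winning S F W Eve s)))"
proof -
  interpret fraisse_class S F
    using assms(1,3,4) by unfold_locales
  have wap: "WAP S F" if "\<U> \<subseteq> sigma_class S F" "\<U> \<prec> (UNIV :: real set)" "BM_emb_winning S F \<U> Odd s" for \<U> s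
    using odd_emb_wins_imp_lepoll[OF _ that(1,3)] not_lepoll_Times_nat[OF that(2)] by blast
  have generic: "\<exists>U\<in>sigma_class S F.
      (\<exists>s. BM_iso_winning S F U Odd s) \<and>
      (\<forall>V\<in>sigma_class S F. (\<exists>s. BM_iso_winning S F V Odd s) \<longrightarrow> isomorphic S V U) \<and>
      (\<forall>M\<in>sigma_class S F.
         (isomorphic S M U \<longleftrightarrow> weakly_injective S F M) \<and>
         (isomorphic S M U \<longleftrightarrow> universal S F M \<and> prehomogeneous S M))" if "WAP S F"
  proof -
    obtain U where U: "weakly_injective S F U"
      using weakly_injective_exists[OF \<open>WAP S F\<close> assms(5,6)] by blast
    \<comment> \<open>A weakly injective \<open>M\<close> lets Odd win, as does \<open>U\<close>, so
      uniqueness for the game supplies the isomorphism.\<close>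
    have iso: "isomorphic S M U \<longleftrightarrow> weakly_injective S F M" if "M \<in> sigma_class S F" for M
      using weakly_injective_isomorphic[OF U that] weakly_injective_odd_wins[OF U]
        weakly_injective_odd_wins[of M] odd_wins_unique by blast
    have pre: "weakly_injective S F M \<longleftrightarrow> universal S F M \<and> prehomogeneous S M" for M
      using weakly_injective_universal weakly_injective_prehomogeneous prehomogeneous_weakly_injective by blast
    show ?thesis
      using weakly_injective_sigma[OF U] weakly_injective_odd_wins[OF U] odd_wins_unique iso pre by blast
  qed
  show ?thesis
    using wap generic not_WAP_eve_wins eve_wins_iso_of_emb by blast
qed

end
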